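(* Given a simple cactus graph $G=(V,E)$, there is a polynomial time algorithm that solves graphic matroid MLOP on $G$, i.e., that finds a bijection $\sigma:E\to\{1,\dots,|E|\}$ minimizing $\sum_{i=1}^{|E|} r(\{e:\sigma(e)\le i\})$, where $r$ is the rank function of the graphic matroid of $G$.
   Context: A cactus graph is a graph in which every block (maximal connected subgraph without a cut vertex) is an edge or a cycle. The rank function of the graphic matroid of $G$ assigns to $A\subseteq E$ the size of a largest acyclic subset of $A$. *)

theory Defs
  imports "HOL-Computational_Algebra.Polynomial"
begin

section \<open>Simple graphs, blocks and cacti\<close>

definition simple_graph :: "'a set \<Rightarrow> 'a set set \<Rightarrow> bool" where
  "simple_graph V E \<longleftrightarrow> finite V \<and> (\<forall>e\<in>E. e \<subseteq> V \<and> card e = 2)"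

definition subgraph :: "'a set \<Rightarrow> 'a set set \<Rightarrow> 'a set \<Rightarrow> 'a set set \<Rightarrow> bool" where
  "subgraph W F V E \<longleftrightarrow> W \<subseteq> V \<and> F \<subseteq> E \<and> (\<forall>e\<in>F. e \<subseteq> W)"

definition linked :: "'a set set \<Rightarrow> 'a \<Rightarrow> 'a \<Rightarrow> bool" where
  "linked E u v \<longleftrightarrow> (u, v) \<in> {(x, y). {x, y} \<in> E}\<^sup>*"

definition connected_graph :: "'a set \<Rightarrow> 'a set set \<Rightarrow> bool" where
  "connected_graph V E \<longleftrightarrow> V \<noteq> {} \<and> (\<forall>u\<in>V. \<forall>v\<in>V. linked E u v)"

text \<open>A cut vertex separates two other vertices of the same component.\<close>

definition cut_vertex :: "'a set \<Rightarrow> 'a set set \<Rightarrow> 'a \<Rightarrow> bool" where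
  "cut_vertex V E v \<longleftrightarrow> v \<in> V \<and>
     (\<exists>x\<in>V - {v}. \<exists>y\<in>V - {v}. linked E x y \<and> \<not> linked {e \<in> E. v \<notin> e} x y)"

definition nonseparable :: "'a set \<Rightarrow> 'a set set \<Rightarrow> bool" where
  "nonseparable V E \<longleftrightarrow> connected_graph V E \<and> (\<nexists>v. cut_vertex V E v)"

definition block :: "'a set \<Rightarrow> 'a set set \<Rightarrow> 'a set \<Rightarrow> 'a set set \<Rightarrow> bool" where
  "block W F V E \<longleftrightarrow> subgraph W F V E \<and> nonseparable W F \<and>
     (\<forall>W' F'. subgraph W' F' V E \<and> nonseparable W' F' \<and> W \<subseteq> W' \<and> F \<subseteq> F' \<longrightarrow> W' = W \<and> F' = F)"

definition edge_graph :: "'a set \<Rightarrow> 'a set set \<Rightarrow> bool" where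
  "edge_graph W F \<longleftrightarrow> (\<exists>u v. u \<noteq> v \<and> W = {u, v} \<and> F = {{u, v}})"

definition cycle_graph :: "'a set \<Rightarrow> 'a set set \<Rightarrow> bool" where
  "cycle_graph W F \<longleftrightarrow> (\<exists>xs. distinct xs \<and> length xs \<ge> 3 \<and> W = set xs \<and>
     F = {{xs ! i, xs ! (Suc i mod length xs)} | i. i < length xs})"

definition cactus :: "'a set \<Rightarrow> 'a set set \<Rightarrow> bool" where
  "cactus V E \<longleftrightarrow> (\<forall>W F. block W F V E \<longrightarrow> edge_graph W F \<or> cycle_graph W F)"


section \<open>The graphic matroid and its minimum linear ordering problem\<close>

definition acyclic_edges :: "'a set set \<Rightarrow> bool" where
  "acyclic_edges B \<longleftrightarrow> (\<nexists>W F. cycle_graph W F \<and> F \<subseteq> B)"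

definition graphic_rank :: "'a set set \<Rightarrow> nat" where
  "graphic_rank A = Max (card ` {B. B \<subseteq> A \<and> acyclic_edges B})"

definition mlop_cost :: "'a set set \<Rightarrow> ('a set \<Rightarrow> nat) \<Rightarrow> nat" where
  "mlop_cost E \<sigma> = (\<Sum>i=1..card E. graphic_rank {e \<in> E. \<sigma> e \<le> i})"

definition mlop_solution :: "'a set set \<Rightarrow> ('a set \<Rightarrow> nat) \<Rightarrow> bool" where
  "mlop_solution E \<sigma> \<longleftrightarrow> bij_betw \<sigma> E {1..card E} \<and>
     (\<forall>\<tau>. bij_betw \<tau> E {1..card E} \<longrightarrow> mlop_cost E \<sigma> \<le> mlop_cost E \<tau>)"


section \<open>Model of computation\<close>

text \<open>
  Algorithms are structured programs for a random access machine. Memory is organised in named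
  unbounded arrays of natural numbers, of which a program can mention only finitely many; scalars
  are kept in cell 0 of an array. Every operation has unit cost. The arithmetic operations are
  addition and truncated subtraction only: without multiplication a number of bit length \<open>b\<close> grows
  to at most \<open>b + O(t)\<close> bits in \<open>t\<close> steps, so that polynomial time on this machine coincides with
  polynomial time on Turing machines.
\<close>

type_synonym state = "string \<Rightarrow> nat \<Rightarrow> nat"

datatype aexp = Const nat | Cell string aexp | Add aexp aexp | Sub aexp aexp

datatype bexp = Less aexp aexp | Eq aexp aexp | Neg bexp | Conj bexp bexp

datatype com =
    Skip
  | Assign string aexp aexp  \<comment> \<open>\<open>Assign x a b\<close> is the array update \<open>x[a] := b\<close>\<close>
  | Seq com com
  | Cond bexp com com
  | While bexp com

primrec aval :: "aexp \<Rightarrow> state \<Rightarrow> nat" where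
  "aval (Const k) s = k"
| "aval (Cell x a) s = s x (aval a s)"
| "aval (Add a b) s = aval a s + aval b s"
| "aval (Sub a b) s = aval a s - aval b s"

primrec bval :: "bexp \<Rightarrow> state \<Rightarrow> bool" where
  "bval (Less a b) s = (aval a s < aval b s)"
| "bval (Eq a b) s = (aval a s = aval b s)"
| "bval (Neg b) s = (\<not> bval b s)"
| "bval (Conj b c) s = (bval b s \<and> bval c s)"

primrec acost :: "aexp \<Rightarrow> nat" where
  "acost (Const k) = 1"
| "acost (Cell x a) = 1 + acost a"
| "acost (Add a b) = 1 + acost a + acost b"
| "acost (Sub a b) = 1 + acost a + acost b"

primrec bcost :: "bexp \<Rightarrow> nat" where
  "bcost (Less a b) = 1 + acost a + acost b"
| "bcost (Eq a b) = 1 + acost a + acost b"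
| "bcost (Neg b) = 1 + bcost b"
| "bcost (Conj b c) = 1 + bcost b + bcost c"

text \<open>\<open>exec c s t s'\<close>: started in \<open>s\<close>, the program \<open>c\<close> halts in \<open>s'\<close> after \<open>t\<close> steps.\<close>

inductive exec :: "com \<Rightarrow> state \<Rightarrow> nat \<Rightarrow> state \<Rightarrow> bool" where
  Skip: "exec Skip s 1 s"
| Assign: "exec (Assign x a b) s (1 + acost a + acost b)
     (s(x := (s x)(aval a s := aval b s)))"
| Seq: "exec c s t s' \<Longrightarrow> exec d s' t' s'' \<Longrightarrow> exec (Seq c d) s (1 + t + t') s''"
| CondTrue: "bval b s \<Longrightarrow> exec c s t s' \<Longrightarrow> exec (Cond b c d) s (1 + bcost b + t) s'"
| CondFalse: "\<not> bval b s \<Longrightarrow> exec d s t s' \<Longrightarrow> exec (Cond b c d) s (1 + bcost b + t) s'"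
| WhileFalse: "\<not> bval b s \<Longrightarrow> exec (While b c) s (1 + bcost b) s"
| WhileTrue: "bval b s \<Longrightarrow> exec c s t s' \<Longrightarrow> exec (While b c) s' t' s'' \<Longrightarrow>
     exec (While b c) s (1 + bcost b + t + t') s''"

inductive_cases SkipE: "exec Skip s t s'"
inductive_cases AssignE: "exec (Assign x a b) s t s'"
inductive_cases SeqE: "exec (Seq c d) s t s'"
inductive_cases CondE: "exec (Cond b c d) s t s'"
inductive_cases WhileE: "exec (While b c) s t s'"

lemma exec_deterministic:
  "exec c s t s' \<Longrightarrow> exec c s u r \<Longrightarrow> u = t \<and> r = s'"
proof (induction arbitrary: u r rule: exec.induct)
  case (Skip s)
  then show ?case by (auto elim: SkipE)
next
  case (Assign x a b s)
  then show ?case by (auto elim: AssignE)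
next
  case (Seq c s t s' d t' s'')
  from Seq.prems obtain t1 s1 t2 where *: "exec c s t1 s1" "exec d s1 t2 r" "u = 1 + t1 + t2"
    by (auto elim: SeqE)
  have "t1 = t \<and> s1 = s'" using *(1) by (rule Seq.IH(1))
  with * Seq.IH(2)[of t2 r] show ?case by simp
next
  case (CondTrue b s c t s' d)
  from CondTrue.prems CondTrue.hyps obtain t1 where *: "exec c s t1 r" "u = 1 + bcost b + t1"
    by (auto elim: CondE)
  with CondTrue.IH[of t1 r] show ?case by simp
next
  case (CondFalse b s d t s' c)
  from CondFalse.prems CondFalse.hyps obtain t1 where *: "exec d s t1 r" "u = 1 + bcost b + t1"
    by (auto elim: CondE)
  with CondFalse.IH[of t1 r] show ?case by simp
next
  case (WhileFalse b s c)
  from WhileFalse.prems WhileFalse.hyps show ?case by (auto elim: WhileE)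
next
  case (WhileTrue b s c t s' t' s'')
  from WhileTrue.prems WhileTrue.hyps obtain t1 s1 t2
    where *: "exec c s t1 s1" "exec (While b c) s1 t2 r" "u = 1 + bcost b + t1 + t2"
    by (auto elim: WhileE)
  have "t1 = t \<and> s1 = s'" using *(1) by (rule WhileTrue.IH(1))
  with * WhileTrue.IH(2)[of t2 r] show ?case by simp
qed


section \<open>Input of graphs\<close>

text \<open>
  A graph is presented to the machine by numbering its vertices as in the list \<open>vs\<close> and listing
  its edges, in any order and orientation, as pairs \<open>ps\<close> of vertex numbers.
\<close>

definition decode_edge :: "'a list \<Rightarrow> nat \<times> nat \<Rightarrow> 'a set" where
  "decode_edge vs p = {vs ! fst p, vs ! snd p}"

definition presents :: "'a list \<Rightarrow> (nat \<times> nat) list \<Rightarrow> 'a set \<Rightarrow> 'a set set \<Rightarrow> bool" where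
  "presents vs ps V E \<longleftrightarrow> distinct vs \<and> set vs = V \<and>
     (\<forall>p\<in>set ps. fst p < length vs \<and> snd p < length vs) \<and>
     distinct (map (decode_edge vs) ps) \<and> set (map (decode_edge vs) ps) = E"

definition input_state :: "nat \<Rightarrow> (nat \<times> nat) list \<Rightarrow> state" where
  "input_state n ps = (\<lambda>x i. 0)
     (''n'' := (\<lambda>i. 0)(0 := n),
      ''m'' := (\<lambda>i. 0)(0 := length ps),
      ''u'' := (\<lambda>k. if k < length ps then fst (ps ! k) else 0),
      ''v'' := (\<lambda>k. if k < length ps then snd (ps ! k) else 0))"

text \<open>\<open>sigma[k]\<close> is the position assigned to the \<open>k\<close>-th edge of the input.\<close>

definition outputs_ordering ::
  "state \<Rightarrow> 'a list \<Rightarrow> (nat \<times> nat) list \<Rightarrow> ('a set \<Rightarrow> nat) \<Rightarrow> bool" where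
  "outputs_ordering s vs ps \<sigma> \<longleftrightarrow>
     (\<forall>k<length ps. s ''sigma'' k = \<sigma> (decode_edge vs (ps ! k)))"

end

theory Submission
  imports Defs
begin

text \<open>
  In a cactus distinct cycles share no edge, since the union of two cycles with a common edge is
  nonseparable and hence contained in a block. So the rank of an edge set is its size minus the
  number of cycles it contains, and minimising the cost means minimising the sum of the completion
  times of the cycles. As in single-machine scheduling, it is optimal to take the cycles one after
  the other in order of increasing length, with the bridges at the end.

  Two edges of a cactus lie on a common cycle iff neither is a bridge and deleting one of them makes
  the other a bridge. Deciding this by labelling connected components yields for each edge the length
  of its cycle and the largest edge number on that cycle, and the edges are sorted by these two numbers.
\<close>

section \<open>Cycles of a cactus\<close>

text \<open>Length alone would be too weak a sorting criterion: the edges of two cycles of equal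
  length could interleave, which delays the cycle that is completed first. The largest edge number
  separates them, because disjoint cycles have different largest edges. Bridges go through the same
  test as cycle edges: after deletion of a bridge its ends stay apart whatever else is deleted, so
  every edge counts as its companion. A bridge therefore gets the key of the full edge set, which
  exceeds the key of every cycle, as a cycle misses that bridge; this is what puts the bridges at
  the end. The test is made afresh for every pair of edges by a plain relabelling of components,
  with about \<open>m * n\<close> steps per pair, and this is the source of the quartic time
  bound.\<close>

lemma linked_refl: "linked E x x"
  by (simp add: linked_def)

lemma linked_trans: "linked E x y \<Longrightarrow> linked E y z \<Longrightarrow> linked E x z"
  unfolding linked_def by (rule rtrancl_trans)

lemma linked_edge: "{x, y} \<in> E \<Longrightarrow> linked E x y"
  unfolding linked_def by (rule r_into_rtrancl) simp

lemma linked_sym: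
  assumes "linked E x y"
  shows "linked E y x"
proof -
  have "sym {(x, y). {x, y} \<in> E}"
    by (auto simp: sym_def insert_commute)
  then show ?thesis
    using assms unfolding linked_def by (meson sym_rtrancl symD)
qed

lemma linked_mono: "linked E x y \<Longrightarrow> E \<subseteq> E' \<Longrightarrow> linked E' x y"
  unfolding linked_def by (rule subsetD[OF rtrancl_mono]) auto

lemma linked_empty_iff: "linked {} x y \<longleftrightarrow> x = y"
  by (simp add: linked_def)

text \<open>Up to shortcuts a path crosses the new edge at most once, so induction along the path
  only has to remember at which end it entered. This is what makes merging two component labels
  correct when an edge is added.\<close>

lemma linked_insert_iff:
  "linked (insert {a, b} E) x y \<longleftrightarrow>
     linked E x y \<or> linked E x a \<and> linked E b y \<or> linked E x b \<and> linked E a y"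
  (is "?L \<longleftrightarrow> ?R y")
proof
  assume ?L
  then have "(x, y) \<in> {(x, y). {x, y} \<in> insert {a, b} E}\<^sup>*"
    by (simp add: linked_def)
  then show "?R y"
  proof (induction rule: rtrancl_induct)
    case base
    show ?case by (simp add: linked_refl)
  next
    case (step y z)
    then consider "{y, z} \<in> E" | "y = a" "z = b" | "y = b" "z = a"
      by (auto simp: doubleton_eq_iff)
    then show ?case
      by cases (use step.IH in \<open>meson linked_edge linked_trans linked_refl\<close>)+
  qed
next
  have mono: "linked (insert {a, b} E) p q" if "linked E p q" for p q
    using that by (rule linked_mono) auto
  have ab: "linked (insert {a, b} E) a b"
    by (rule linked_edge) simp
  assume "?R y"
  then show ?L
    using mono ab linked_sym[OF ab] by (meson linked_trans)
qed

lemma linked_arc: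
  fixes f :: "nat \<Rightarrow> 'a"
  assumes "\<And>d. d < k \<Longrightarrow> {f (a + d), f (Suc (a + d))} \<in> F"
  shows "linked F (f a) (f (a + k))"
  using assms
proof (induction k)
  case 0
  show ?case by (simp add: linked_refl)
next
  case (Suc k)
  have "linked F (f (a + k)) (f (a + Suc k))"
    using Suc.prems[of k] by (simp add: linked_edge)
  then show ?case
    using Suc by (meson linked_trans less_SucI)
qed

text \<open>Cycles are parametrised by functions of period \<open>n\<close> on all natural numbers, so that indices
  need not be reduced modulo \<open>n\<close>.\<close>

definition cyclic_map :: "nat \<Rightarrow> (nat \<Rightarrow> 'a) \<Rightarrow> bool" where
  "cyclic_map n f \<longleftrightarrow> 3 \<le> n \<and> (\<forall>i j. f i = f j \<longleftrightarrow> i mod n = j mod n)"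

lemma cyclic_map_ge: "cyclic_map n f \<Longrightarrow> 3 \<le> n"
  by (simp add: cyclic_map_def)

lemma cyclic_map_add: "cyclic_map n f \<Longrightarrow> f (i + d) = f i \<longleftrightarrow> n dvd d"
  by (simp add: cyclic_map_def mod_eq_dvd_iff_nat)

lemma cyclic_map_Suc: "cyclic_map n f \<Longrightarrow> f (Suc i) = f (Suc j) \<longleftrightarrow> f i = f j"
  by (simp add: cyclic_map_def nat_mod_eq_iff)

lemma cycle_graphE:
  assumes "cycle_graph W F"
  obtains n f where "cyclic_map n f" "W = range f" "F = range (\<lambda>i. {f i, f (Suc i)})"
proof -
  obtain xs where xs: "distinct xs" "3 \<le> length xs" "W = set xs"
    and F: "F = {{xs ! i, xs ! (Suc i mod length xs)} | i. i < length xs}"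
    using assms by (auto simp: cycle_graph_def)
  define n where "n = length xs"
  define f where "f i = xs ! (i mod n)" for i
  have n: "3 \<le> n" using xs n_def by simp
  then have lt: "i mod n < length xs" for i
    unfolding n_def by (intro mod_less_divisor) linarith
  have f: "cyclic_map n f"
    using xs n lt by (simp add: cyclic_map_def f_def nth_eq_iff_index_eq)
  have W: "W = range f"
  proof
    show "W \<subseteq> range f"
      using xs(3) by (auto simp: in_set_conv_nth f_def n_def image_iff) (metis mod_less)
    show "range f \<subseteq> W"
      using xs lt by (auto simp: f_def)
  qed
  have "F = range (\<lambda>i. {f i, f (Suc i)})"
  proof
    show "F \<subseteq> range (\<lambda>i. {f i, f (Suc i)})"
      unfolding F by (auto simp: f_def n_def image_iff) (metis mod_less)
    show "range (\<lambda>i. {f i, f (Suc i)}) \<subseteq> F"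
    proof safe
      fix i
      have "{f i, f (Suc i)} = {xs ! (i mod n), xs ! (Suc (i mod n) mod length xs)}"
        by (simp add: f_def n_def mod_Suc_eq)
      then show "{f i, f (Suc i)} \<in> F" unfolding F using lt by blast
    qed
  qed
  from that[OF f W this] show thesis .
qed

lemma cycle_linked_minus_edge:
  assumes "cycle_graph W F" "{u, v} \<in> F"
  shows "linked (F - {{u, v}}) u v"
proof -
  obtain n f where f: "cyclic_map n f" and F: "F = range (\<lambda>i. {f i, f (Suc i)})"
    using cycle_graphE[OF assms(1)] by metis
  note n = cyclic_map_ge[OF f] and dvd = cyclic_map_add[OF f]
  obtain i where i: "{u, v} = {f i, f (Suc i)}" using assms(2) F by auto
  have "linked (F - {{u, v}}) (f (Suc i)) (f (Suc i + (n - 1)))"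
  proof (rule linked_arc)
    fix d assume d: "d < n - 1"
    \<comment> \<open>The arc runs the other way round, from \<open>f (Suc i)\<close> to
      \<open>f (i + n)\<close>. One of its edges could equal the deleted one only by returning to
      \<open>f i\<close> too early or, for \<open>d = 0\<close>, if \<open>f (i + 2) = f i\<close>;
      the latter is where \<open>3 \<le> n\<close> matters.\<close>
    have "f (i + Suc d) \<noteq> f i"
      unfolding dvd using d by (auto dest: dvd_imp_le)
    moreover have "f (i + 2) \<noteq> f i"
      unfolding dvd using n by (auto dest: dvd_imp_le)
    moreover have "f (Suc i + d) = f (Suc i) \<Longrightarrow> d = 0"
      unfolding dvd using d by (auto dest: dvd_imp_le)
    ultimately have "{f (Suc i + d), f (Suc (Suc i + d))} \<noteq> {u, v}"
      unfolding i by (auto simp: doubleton_eq_iff numeral_2_eq_2)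
    then show "{f (Suc i + d), f (Suc (Suc i + d))} \<in> F - {{u, v}}"
      unfolding F by auto
  qed
  moreover have "f (Suc i + (n - 1)) = f i"
    using dvd[of i n] n by simp
  ultimately have "linked (F - {{u, v}}) (f (Suc i)) (f i)" by simp
  then show ?thesis
    using i by (metis doubleton_eq_iff linked_sym)
qed

lemma cycle_nonseparable:
  assumes "cycle_graph W F"
  shows "nonseparable W F"
proof -
  obtain n f where f: "cyclic_map n f" and W: "W = range f" and F: "F = range (\<lambda>i. {f i, f (Suc i)})"
    using cycle_graphE[OF assms] by metis
  note n = cyclic_map_ge[OF f] and dvd = cyclic_map_add[OF f]
  have "linked F (f 0) (f j)" for j
    using linked_arc[of j f 0 F] unfolding F by auto
  then have "linked F (f i) (f j)" for i j
    using linked_sym linked_trans by metis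
  then have conn: "connected_graph W F"
    by (simp add: connected_graph_def W)
  have "\<not> cut_vertex W F v" for v
  proof
    assume "cut_vertex W F v"
    then obtain x y where v: "v \<in> W" and xy: "x \<in> W - {v}" "y \<in> W - {v}"
      and not: "\<not> linked {e \<in> F. v \<notin> e} x y"
      unfolding cut_vertex_def by auto
    obtain k where k: "v = f k" using v W by auto
    have "linked {e \<in> F. v \<notin> e} (f (Suc k)) z" if "z \<in> W - {v}" for z
    proof -
      obtain j where j: "z = f j" using \<open>z \<in> W - {v}\<close> W by auto
      \<comment> \<open>\<open>d\<close> is the distance from \<open>f k\<close> to \<open>z\<close>
        along the cycle. The multiple \<open>n * k\<close> is added first because
        \<open>j - k\<close> would be truncated at 0.\<close>
      define d where "d = (j + n * k - k) mod n"
      have "k \<le> n * k" using n by simp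
      then have "(j + n * k - k) = d + n * ((j + n * k - k) div n)"
        by (simp add: d_def)
      then have "j + n * k = (k + d) + n * ((j + n * k - k) div n)"
        using \<open>k \<le> n * k\<close> by linarith
      then have z: "z = f (k + d)"
        unfolding j by (metis dvd dvd_triv_left)
      have d0: "d \<noteq> 0" using \<open>z \<in> W - {v}\<close> z k by (metis DiffE add_0_right singletonI)
      have dn: "d < n" using n by (simp add: d_def)
      have "linked {e \<in> F. v \<notin> e} (f (Suc k)) (f (Suc k + (d - 1)))"
      proof (rule linked_arc)
        fix e assume e: "e < d - 1"
        have "f (k + Suc e) \<noteq> f k" "f (k + Suc (Suc e)) \<noteq> f k"
          unfolding dvd using e dn by (auto dest!: dvd_imp_le)
        then show "{f (Suc k + e), f (Suc (Suc k + e))} \<in> {e \<in> F. v \<notin> e}"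
          unfolding F k by auto
      qed
      then show ?thesis using d0 z by simp
    qed
    with xy not show False by (meson linked_sym linked_trans)
  qed
  with conn show ?thesis by (simp add: nonseparable_def)
qed

lemma cycle_edge_subset: "cycle_graph W F \<Longrightarrow> e \<in> F \<Longrightarrow> e \<subseteq> W"
  by (elim cycle_graphE) auto

lemma cycle_graph_vertices: "cycle_graph W F \<Longrightarrow> W = \<Union>F"
  by (elim cycle_graphE) auto

lemma cycle_not_subset_single:
  assumes "cycle_graph W F"
  shows "\<not> F \<subseteq> {e}"
proof
  assume sub: "F \<subseteq> {e}"
  obtain n f where f: "cyclic_map n f" and F: "F = range (\<lambda>i. {f i, f (Suc i)})"
    using cycle_graphE[OF assms] by metis
  note n = cyclic_map_ge[OF f] and dvd = cyclic_map_add[OF f]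
  have "{f 0, f (Suc 0)} = {f (Suc 0), f (Suc (Suc 0))}"
    using sub unfolding F by (simp add: image_subset_iff)
  moreover have "f (0 + Suc 0) \<noteq> f 0" "f (0 + Suc (Suc 0)) \<noteq> f 0"
    unfolding dvd using n by (auto dest!: dvd_imp_le)
  ultimately show False by (auto simp: doubleton_eq_iff)
qed

text \<open>Used to identify two cycles with a cycle that contains both. The walk along
  \<open>F'\<close> from a shared edge never leaves \<open>F\<close>, and by periodicity it passes
  every edge of \<open>F'\<close>.\<close>

lemma cycle_subset_cycle_eq:
  assumes "cycle_graph W F" "cycle_graph W' F'" "F \<subseteq> F'"
  shows "F = F'"
proof -
  obtain n f where f: "cyclic_map n f" and F: "F = range (\<lambda>i. {f i, f (Suc i)})"
    using cycle_graphE[OF assms(1)] by metis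
  note n = cyclic_map_ge[OF f] and dvd = cyclic_map_add[OF f]
  obtain m g where g: "cyclic_map m g" and F': "F' = range (\<lambda>i. {g i, g (Suc i)})"
    using cycle_graphE[OF assms(2)] by metis
  note m = cyclic_map_ge[OF g] and dvd' = cyclic_map_add[OF g]
  \<comment> \<open>A vertex of \<open>F\<close> has two neighbours in \<open>F\<close> and only two in \<open>F'\<close>.\<close>
  have step: "{g k, g (Suc k)} \<in> F" if gk: "g k \<in> range f" for k
  proof -
    obtain i0 where "g k = f i0" using gk by auto
    \<comment> \<open>A whole turn is added so that the vertex has a predecessor index even if
      \<open>i0 = 0\<close>.\<close>
    then have "g k = f (Suc (i0 + n - 1))" using dvd[of i0 n] n by simp
    then obtain i where i: "g k = f (Suc i)" by blast
    have ne: "f i \<noteq> f (Suc (Suc i))"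
      using dvd[of i 2] n by (auto dest: dvd_imp_le)
    have edges: "{g k, f i} \<in> F" "{g k, f (Suc (Suc i))} \<in> F"
      unfolding F i by (auto simp: insert_commute)
    have nb: "z = g (Suc k) \<or> (\<exists>l. z = g l \<and> g (Suc l) = g k)" if z: "{g k, z} \<in> F'" for z
    proof -
      obtain l where "{g k, z} = {g l, g (Suc l)}" using z unfolding F' by blast
      then show ?thesis
        using cyclic_map_Suc[OF g] by (auto simp: doubleton_eq_iff)
    qed
    \<comment> \<open>The predecessor of \<open>g k\<close> on \<open>F'\<close> is unique, so the
      two distinct neighbours \<open>f i\<close> and \<open>f (Suc (Suc i))\<close> cannot both be
      it.\<close>
    have "f i = g (Suc k) \<or> f (Suc (Suc i)) = g (Suc k)"
      using nb[of "f i"] nb[of "f (Suc (Suc i))"] edges assms(3) ne cyclic_map_Suc[OF g]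
      by (metis subsetD)
    then show ?thesis using edges by auto
  qed
  have "{f 0, f (Suc 0)} \<in> F'" using assms(3) F by auto
  then obtain k0 where "{f 0, f (Suc 0)} = {g k0, g (Suc k0)}"
    unfolding F' by blast
  then have "g k0 \<in> {f 0, f (Suc 0)}" by simp
  then have "g k0 \<in> range f" by auto
  moreover have "g (Suc k) \<in> range f" if "g k \<in> range f" for k
    using step[OF that] unfolding F by (auto simp: doubleton_eq_iff)
  ultimately have all: "g (k0 + d) \<in> range f" for d
    by (induction d) auto
  have "g l \<in> range f" for l
  proof -
    \<comment> \<open>A multiple of the period lifts every index \<open>l\<close> above the starting
      index \<open>k0\<close>.\<close>
    have "k0 \<le> m * k0" using m by simp
    then have "l + m * k0 = k0 + (l + (m * k0 - k0))" by linarith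
    moreover have "g (l + m * k0) = g l" by (simp add: dvd')
    ultimately show ?thesis using all by metis
  qed
  then have "F' \<subseteq> F" using step unfolding F' by auto
  with assms(3) show ?thesis by auto
qed

section \<open>Nonseparable subgraphs and blocks\<close>

lemma nonseparable_linked_avoiding:
  assumes "nonseparable W F" "\<forall>e\<in>F. e \<subseteq> W" "x \<in> W - {v}" "y \<in> W - {v}"
  shows "linked {e \<in> F. v \<notin> e} x y"
proof -
  have xy: "linked F x y"
    using assms by (auto simp: nonseparable_def connected_graph_def)
  show ?thesis
  proof (cases "v \<in> W")
    case True
    then show ?thesis
      using assms xy unfolding nonseparable_def cut_vertex_def by blast
  next
    \<comment> \<open>The deleted vertex may lie outside \<open>W\<close>: in a union of two graphs
      it ranges over the vertices of both.\<close>
    case False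
    then have "{e \<in> F. v \<notin> e} = F" using assms(2) by auto
    with xy show ?thesis by simp
  qed
qed

text \<open>With two common vertices, deleting any \<open>v\<close> leaves a common vertex
  \<open>c\<close>, and every remaining vertex still reaches \<open>c\<close> inside its own part. A
  single common vertex could itself become a cut vertex.\<close>

lemma nonseparable_Un:
  assumes ns: "nonseparable W F" "nonseparable W' F'"
    and sub: "\<forall>e\<in>F. e \<subseteq> W" "\<forall>e\<in>F'. e \<subseteq> W'"
    and ab: "a \<in> W \<inter> W'" "b \<in> W \<inter> W'" "a \<noteq> b"
  shows "nonseparable (W \<union> W') (F \<union> F')"
proof -
  have "linked (F \<union> F') a x" if "x \<in> W \<union> W'" for x
    using that ns ab unfolding nonseparable_def connected_graph_def
    by (metis IntD1 IntD2 Un_iff Un_upper1 Un_upper2 linked_mono)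
  then have conn: "connected_graph (W \<union> W') (F \<union> F')"
    unfolding connected_graph_def using ab linked_sym linked_trans
    by (metis Int_iff Un_empty empty_iff)
  have "\<not> cut_vertex (W \<union> W') (F \<union> F') v" for v
  proof
    assume "cut_vertex (W \<union> W') (F \<union> F') v"
    then obtain x y where xy: "x \<in> W \<union> W' - {v}" "y \<in> W \<union> W' - {v}"
      and not: "\<not> linked {e \<in> F \<union> F'. v \<notin> e} x y"
      unfolding cut_vertex_def by auto
    obtain c where c: "c \<in> W - {v}" "c \<in> W' - {v}" using ab by auto
    have "linked {e \<in> F \<union> F'. v \<notin> e} c z" if "z \<in> W \<union> W' - {v}" for z
    proof -
      have "linked {e \<in> F. v \<notin> e} c z \<or> linked {e \<in> F'. v \<notin> e} c z"
        using that c nonseparable_linked_avoiding[OF ns(1) sub(1)]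
          nonseparable_linked_avoiding[OF ns(2) sub(2)] by blast
      then show ?thesis by (auto elim!: linked_mono)
    qed
    with xy not show False by (meson linked_sym linked_trans)
  qed
  with conn show ?thesis by (simp add: nonseparable_def)
qed

lemma finite_edges: "simple_graph V E \<Longrightarrow> finite E"
  unfolding simple_graph_def by (meson Pow_iff finite_Pow_iff finite_subset subsetI)

text \<open>Enlarging either component of a finite pair strictly increases the sum of the two
  cardinalities, so a pair that maximises this sum is maximal in the componentwise order used by
  \<open>block\<close>.\<close>

lemma nonseparable_in_block:
  assumes "simple_graph V E" "subgraph W F V E" "nonseparable W F"
  obtains W' F' where "block W' F' V E" "W \<subseteq> W'" "F \<subseteq> F'"
proof -
  define S where "S = {(W', F'). subgraph W' F' V E \<and> nonseparable W' F' \<and> W \<subseteq> W' \<and> F \<subseteq> F'}"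
  define size where "size C = card (fst C) + card (snd C)" for C :: "'a set \<times> 'a set set"
  have fin: "finite V" "finite E"
    using assms(1) finite_edges by (auto simp: simple_graph_def)
  have "S \<subseteq> Pow V \<times> Pow E" by (auto simp: S_def subgraph_def)
  then have "finite S" using fin by (meson finite_Pow_iff finite_SigmaI finite_subset)
  moreover have "(W, F) \<in> S" using assms by (auto simp: S_def)
  ultimately have "Max (size ` S) \<in> size ` S" "\<And>C. C \<in> S \<Longrightarrow> size C \<le> Max (size ` S)"
    by (auto intro!: Max_in)
  then obtain B where B: "B \<in> S" and max: "\<And>C. C \<in> S \<Longrightarrow> size C \<le> size B"
    by (metis imageE)
  obtain W1 F1 where B1: "B = (W1, F1)" by (cases B)
  have "block W1 F1 V E"
    unfolding block_def
  proof (intro conjI allI impI)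
    show "subgraph W1 F1 V E" "nonseparable W1 F1" using B by (auto simp: B1 S_def)
    fix W2 F2
    assume *: "subgraph W2 F2 V E \<and> nonseparable W2 F2 \<and> W1 \<subseteq> W2 \<and> F1 \<subseteq> F2"
    then have "(W2, F2) \<in> S" using B by (auto simp: B1 S_def)
    from max[OF this] have le: "card W2 + card F2 \<le> card W1 + card F1" by (simp add: B1 size_def)
    have f: "finite W2" "finite F2"
      using * fin by (auto simp: subgraph_def intro: finite_subset)
    have "card W1 \<le> card W2" "card F1 \<le> card F2" using * f by (auto intro: card_mono)
    then have "card W1 = card W2" "card F1 = card F2" using le by auto
    then show "W2 = W1" "F2 = F1" using * f by (metis card_subset_eq)+
  qed
  then show thesis using that B by (auto simp: B1 S_def)
qed

definition cycles :: "'a set set \<Rightarrow> 'a set set set" where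
  "cycles E = {F. F \<subseteq> E \<and> (\<exists>W. cycle_graph W F)}"

lemma cactus_cycles_disjoint:
  assumes G: "simple_graph V E" "cactus V E"
    and F: "F \<in> cycles E" "F' \<in> cycles E" "F \<inter> F' \<noteq> {}"
  shows "F = F'"
proof -
  obtain W W' where cyc: "cycle_graph W F" "cycle_graph W' F'" and sub: "F \<subseteq> E" "F' \<subseteq> E"
    using F by (auto simp: cycles_def)
  have edges: "\<forall>e\<in>F. e \<subseteq> W" "\<forall>e\<in>F'. e \<subseteq> W'"
    using cyc cycle_edge_subset by metis+
  obtain e where e: "e \<in> F" "e \<in> F'" using F(3) by auto
  then have "card e = 2" using sub G by (auto simp: simple_graph_def)
  then obtain a b where ab: "e = {a, b}" "a \<noteq> b" by (auto simp: card_2_iff)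
  have ns: "nonseparable (W \<union> W') (F \<union> F')"
    by (rule nonseparable_Un[OF cyc[THEN cycle_nonseparable] edges, of a b])
      (use e ab edges in auto)
  have "subgraph (W \<union> W') (F \<union> F') V E"
    unfolding subgraph_def cycle_graph_vertices[OF cyc(1)] cycle_graph_vertices[OF cyc(2)]
    using sub G by (auto simp: simple_graph_def)
  from nonseparable_in_block[OF G(1) this ns] obtain B D
    where B: "block B D V E" and FD: "F \<subseteq> D" "F' \<subseteq> D" by (metis Un_subset_iff)
  \<comment> \<open>The block contains a cycle, so it is more than an edge and hence itself a cycle;
    then \<open>F\<close> and \<open>F'\<close> both equal its edge set \<open>D\<close>.\<close>
  have "\<not> edge_graph B D"
    using FD(1) cycle_not_subset_single[OF cyc(1)] by (auto simp: edge_graph_def)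
  then have "cycle_graph B D" using B G(2) by (auto simp: cactus_def)
  then show ?thesis using cycle_subset_cycle_eq cyc FD by metis
qed

section \<open>Paths, cycles through a given edge, and bridges\<close>

lemma linked_distinct_path:
  assumes "linked E x y"
  obtains zs where "distinct zs" "zs \<noteq> []" "hd zs = x" "last zs = y"
    "\<And>i. Suc i < length zs \<Longrightarrow> {zs ! i, zs ! Suc i} \<in> E"
proof -
  from assms have "(x, y) \<in> {(x, y). {x, y} \<in> E}\<^sup>*" by (simp add: linked_def)
  then have "\<exists>zs. distinct zs \<and> zs \<noteq> [] \<and> hd zs = x \<and> last zs = y \<and>
     (\<forall>i. Suc i < length zs \<longrightarrow> {zs ! i, zs ! Suc i} \<in> E)"
  proof (induction rule: rtrancl_induct)
    case base
    show ?case by (rule exI[of _ "[x]"]) simp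
  next
    case (step y z)
    then obtain zs where zs: "distinct zs" "zs \<noteq> []" "hd zs = x" "last zs = y"
      and E: "\<And>i. Suc i < length zs \<Longrightarrow> {zs ! i, zs ! Suc i} \<in> E" by auto
    show ?case
    proof (cases "z \<in> set zs")
      \<comment> \<open>If the path already visits \<open>z\<close>, it is cut off there, which
        keeps its vertices distinct.\<close>
      case True
      then obtain k where k: "k < length zs" "zs ! k = z" by (auto simp: in_set_conv_nth)
      then have "length zs \<le> Suc k \<Longrightarrow> k = length zs - Suc 0" by simp
      then show ?thesis
        by (intro exI[of _ "take (Suc k) zs"])
          (use zs E k in \<open>auto simp: last_conv_nth min_def\<close>)
    next
      case False
      have "{y, z} \<in> E" using step by auto
      then show ?thesis
        by (intro exI[of _ "zs @ [z]"])
          (use zs E False in \<open>auto simp: nth_append last_conv_nth less_Suc_eq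
              dest: sym[of "Suc _" "length zs"]\<close>)
    qed
  qed
  then show thesis using that by auto
qed

lemma linked_imp_cycle:
  assumes "linked E u v" "u \<noteq> v" "{u, v} \<notin> E"
  obtains F where "F \<in> cycles (insert {u, v} E)" "{u, v} \<in> F"
proof -
  obtain zs where zs: "distinct zs" "zs \<noteq> []" "hd zs = u" "last zs = v"
    and E: "\<And>i. Suc i < length zs \<Longrightarrow> {zs ! i, zs ! Suc i} \<in> E"
    using linked_distinct_path[OF assms(1)] by metis
  have uv: "zs ! 0 = u" "zs ! (length zs - 1) = v"
    using zs by (auto simp: hd_conv_nth last_conv_nth)
  \<comment> \<open>One vertex would give \<open>u = v\<close>, and two would put
    \<open>{u, v}\<close> into \<open>E\<close>; so closing the path by \<open>{u, v}\<close> yields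
    a cycle of length at least 3.\<close>
  have "length zs \<noteq> 1" "length zs \<noteq> 2" "length zs \<noteq> 0"
    using assms uv zs E[of 0] by (auto simp: numeral_2_eq_2)
  then have len: "3 \<le> length zs" by linarith
  define F where "F = {{zs ! i, zs ! (Suc i mod length zs)} | i. i < length zs}"
  have "cycle_graph (set zs) F"
    unfolding cycle_graph_def F_def using zs len by blast
  moreover have "{zs ! i, zs ! (Suc i mod length zs)} \<in> insert {u, v} E" if "i < length zs" for i
  proof (cases "Suc i < length zs")
    case True
    then show ?thesis using E by simp
  next
    case False
    then have "Suc i = length zs" using that by simp
    then have "i = length zs - 1" "Suc i mod length zs = 0" by auto
    then show ?thesis using uv by (auto simp: insert_commute)
  qed
  moreover have "{u, v} \<in> F"
    unfolding F_def using uv len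
    by (intro CollectI exI[of _ "length zs - 1"]) (auto simp: insert_commute Suc_diff_le[symmetric])
  ultimately have "F \<in> cycles (insert {u, v} E)" "{u, v} \<in> F"
    by (auto simp: cycles_def F_def)
  then show thesis by (rule that)
qed

text \<open>If \<open>e\<close> is off the cycle, the rest of the cycle still joins \<open>u\<close>
  and \<open>v\<close>. Conversely, a remaining path closes up to a cycle through
  \<open>{u, v}\<close> that avoids \<open>e\<close>, whereas \<open>{u, v}\<close> lies on one
  cycle only. For \<open>e = {u, v}\<close> the equivalence fails, which is why
  \<open>companions\<close> treats \<open>i = j\<close> separately.\<close>

lemma linked_minus_edges_iff:
  assumes E: "\<And>F F'. F \<in> cycles E \<Longrightarrow> F' \<in> cycles E \<Longrightarrow> F \<inter> F' \<noteq> {} \<Longrightarrow> F = F'"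
    and F: "F \<in> cycles E" "{u, v} \<in> F" and "u \<noteq> v" "e \<noteq> {u, v}"
  shows "linked (E - {{u, v}, e}) u v \<longleftrightarrow> e \<notin> F"
proof
  assume "e \<notin> F"
  then have "F - {{u, v}} \<subseteq> E - {{u, v}, e}" using F by (auto simp: cycles_def)
  moreover have "linked (F - {{u, v}}) u v"
    using F by (auto simp: cycles_def intro: cycle_linked_minus_edge)
  ultimately show "linked (E - {{u, v}, e}) u v" by (rule linked_mono[rotated])
next
  assume "linked (E - {{u, v}, e}) u v"
  then obtain F' where F': "F' \<in> cycles (insert {u, v} (E - {{u, v}, e}))" "{u, v} \<in> F'"
    using linked_imp_cycle[of "E - {{u, v}, e}" u v] assms(4) by auto
  have "{u, v} \<in> E" using F by (auto simp: cycles_def)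
  then have "F' \<in> cycles E" "e \<notin> F'" using F' assms(5) by (auto simp: cycles_def)
  then show "e \<notin> F" using E[of F F'] F F' by auto
qed

lemma not_linked_minus_bridge:
  assumes "{u, v} \<in> E" "u \<noteq> v" "\<And>F. F \<in> cycles E \<Longrightarrow> {u, v} \<notin> F"
  shows "\<not> linked (E - {{u, v}, e}) u v"
proof
  assume "linked (E - {{u, v}, e}) u v"
  then obtain F where F: "F \<in> cycles (insert {u, v} (E - {{u, v}, e}))" "{u, v} \<in> F"
    using linked_imp_cycle[of "E - {{u, v}, e}" u v] assms(2) by auto
  then have "F \<in> cycles E" using assms(1) by (auto simp: cycles_def)
  with F assms(3) show False by auto
qed

section \<open>Rank and completion times\<close>

lemma cycles_finite: "finite E \<Longrightarrow> finite (cycles E)"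
  by (rule finite_subset[of _ "Pow E"]) (auto simp: cycles_def)

lemma cycles_nonempty: "F \<in> cycles E \<Longrightarrow> F \<noteq> {}"
  using cycle_not_subset_single by (fastforce simp: cycles_def)

text \<open>Every acyclic subset misses an edge of each cycle, and disjointness makes the missed
  edges distinct; removing one edge per cycle attains this bound.\<close>

lemma graphic_rank_disjoint_cycles:
  assumes A: "finite A" and dis: "pairwise disjnt (cycles A)"
  shows "graphic_rank A + card (cycles A) = card A"
proof -
  have upper: "card B + card (cycles A) \<le> card A" if B: "B \<subseteq> A" "acyclic_edges B" for B
  proof -
    have "\<forall>F\<in>cycles A. \<exists>e. e \<in> F - B"
      using B(2) by (fastforce simp: cycles_def acyclic_edges_def)
    then obtain h where h: "\<And>F. F \<in> cycles A \<Longrightarrow> h F \<in> F - B" by metis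
    have "inj_on h (cycles A)"
      by (rule inj_onI) (metis DiffD1 disjnt_iff pairwiseD dis h)
    moreover have "h ` cycles A \<subseteq> A - B" using h by (auto simp: cycles_def)
    ultimately have "card (cycles A) \<le> card (A - B)"
      using A by (metis card_image card_mono finite_Diff)
    also have "\<dots> = card A - card B"
      using A B(1) by (metis card_Diff_subset finite_subset)
    finally show ?thesis using card_mono[OF A B(1)] by linarith
  qed
  have "\<forall>F\<in>cycles A. \<exists>e. e \<in> F" using cycles_nonempty by blast
  then obtain h where h: "\<And>F. F \<in> cycles A \<Longrightarrow> h F \<in> F" by metis
  define B where "B = A - h ` cycles A"
  have "F \<notin> cycles A" if "F \<subseteq> B" for F
    using h[of F] that by (auto simp: B_def)
  then have "acyclic_edges B"
    unfolding acyclic_edges_def cycles_def by (auto simp: B_def)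
  moreover have "card B + card (cycles A) = card A"
  proof -
    have "inj_on h (cycles A)"
      by (rule inj_onI) (metis disjnt_iff pairwiseD dis h)
    moreover have "h ` cycles A \<subseteq> A" using h by (auto simp: cycles_def)
    ultimately have "card B = card A - card (cycles A)" "card (cycles A) \<le> card A"
      unfolding B_def using A
      by (metis card_Diff_subset card_image finite_subset, metis card_image card_mono)
    then show ?thesis by linarith
  qed
  moreover have "graphic_rank A = card B"
    unfolding graphic_rank_def
  proof (rule Max_eqI)
    show "finite (card ` {B. B \<subseteq> A \<and> acyclic_edges B})" using A by simp
    show "card B \<in> card ` {B. B \<subseteq> A \<and> acyclic_edges B}"
      using calculation(1) by (auto simp: B_def)
    show "k \<le> card B" if k: "k \<in> card ` {B. B \<subseteq> A \<and> acyclic_edges B}" for k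
    proof -
      obtain C where "C \<subseteq> A" "acyclic_edges C" "k = card C" using k by auto
      then show ?thesis using upper[of C] calculation(2) by linarith
    qed
  qed
  ultimately show ?thesis by simp
qed

lemma card_bij_prefix:
  assumes "bij_betw \<sigma> E {1..m}" "i \<le> m"
  shows "card {e \<in> E. \<sigma> e \<le> i} = (i::nat)"
proof -
  have "\<sigma> ` {e \<in> E. \<sigma> e \<le> i} = {1..i}"
    using assms by (auto simp: bij_betw_def image_iff set_eq_iff) (metis order_trans)
  moreover have "inj_on \<sigma> {e \<in> E. \<sigma> e \<le> i}"
    using assms(1) by (auto simp: bij_betw_def intro: inj_on_subset)
  ultimately show ?thesis by (metis card_image card_atLeastAtMost diff_Suc_1)
qed

text \<open>A prefix of length \<open>i\<close> has rank \<open>i\<close> minus the number of cycles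
  completed by then, and a cycle completed at position \<open>t\<close> is counted in
  \<open>card E + 1 - t\<close> prefixes. Hence the cost depends on the ordering only through the
  sum of the completion times. The additive form avoids truncated subtraction.\<close>

lemma mlop_cost_completion_times:
  assumes E: "finite E" and dis: "pairwise disjnt (cycles E)" and \<sigma>: "bij_betw \<sigma> E {1..card E}"
  shows "mlop_cost E \<sigma> + card (cycles E) * Suc (card E) =
    \<Sum>{1..card E} + (\<Sum>F\<in>cycles E. Max (\<sigma> ` F))"
proof -
  let ?m = "card E"
  define P where "P i = {e \<in> E. \<sigma> e \<le> i}" for i
  have rank: "graphic_rank (P i) + card (cycles (P i)) = i" if "i \<in> {1..?m}" for i
  proof -
    have "cycles (P i) \<subseteq> cycles E" by (auto simp: cycles_def P_def)
    then have "pairwise disjnt (cycles (P i))" using dis by (meson pairwise_subset)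
    then have "graphic_rank (P i) + card (cycles (P i)) = card (P i)"
      using E by (intro graphic_rank_disjoint_cycles) (auto simp: P_def)
    then show ?thesis
      using card_bij_prefix[OF \<sigma>, of i] that by (simp add: P_def)
  qed
  have Max_le: "Max (\<sigma> ` F) \<le> i \<longleftrightarrow> (\<forall>e\<in>F. \<sigma> e \<le> i)" if "F \<in> cycles E" for F i
    using that E cycles_nonempty[OF that]
    by (subst Max_le_iff) (auto simp: cycles_def dest: finite_subset)
  have Max_m: "Max (\<sigma> ` F) \<in> {1..?m}" if F: "F \<in> cycles E" for F
  proof -
    have "Max (\<sigma> ` F) \<in> \<sigma> ` F"
      using F E cycles_nonempty[OF F] by (intro Max_in) (auto simp: cycles_def dest: finite_subset)
    moreover have "\<sigma> ` F \<subseteq> {1..?m}" using F \<sigma> by (auto simp: cycles_def bij_betw_def)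
    ultimately show ?thesis by auto
  qed
  \<comment> \<open>A cycle lies in a prefix exactly when its last edge does.\<close>
  have "cycles (P i) = {F \<in> cycles E. Max (\<sigma> ` F) \<le> i}" for i
    using Max_le by (auto simp: cycles_def P_def)
  then have "card (cycles (P i)) = (\<Sum>F\<in>cycles E. if Max (\<sigma> ` F) \<le> i then 1 else 0)" for i
    using cycles_finite[OF E] by (simp flip: sum.inter_filter)
  then have "(\<Sum>i=1..?m. card (cycles (P i))) =
      (\<Sum>F\<in>cycles E. \<Sum>i=1..?m. if Max (\<sigma> ` F) \<le> i then 1 else 0)"
    by (simp only: sum.swap[of _ "{1..?m}"])
  also have "\<dots> = (\<Sum>F\<in>cycles E. Suc ?m - Max (\<sigma> ` F))"
  proof (rule sum.cong[OF refl])
    fix F assume "F \<in> cycles E"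
    then have "{i \<in> {1..?m}. Max (\<sigma> ` F) \<le> i} = {Max (\<sigma> ` F)..?m}"
      using Max_m[of F] by auto
    then show "(\<Sum>i=1..?m. if Max (\<sigma> ` F) \<le> i then 1 else 0) = Suc ?m - Max (\<sigma> ` F)"
      by (simp flip: sum.inter_filter)
  qed
  finally have 1: "(\<Sum>i=1..?m. card (cycles (P i))) = (\<Sum>F\<in>cycles E. Suc ?m - Max (\<sigma> ` F))" .
  have "(\<Sum>F\<in>cycles E. Suc ?m - Max (\<sigma> ` F)) + (\<Sum>F\<in>cycles E. Max (\<sigma> ` F))
      = (\<Sum>F\<in>cycles E. Suc ?m)"
    unfolding sum.distrib[symmetric] using Max_m by (intro sum.cong) fastforce+
  then have 2: "(\<Sum>F\<in>cycles E. Suc ?m - Max (\<sigma> ` F)) + (\<Sum>F\<in>cycles E. Max (\<sigma> ` F))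
      = card (cycles E) * Suc ?m" by simp
  have "mlop_cost E \<sigma> + (\<Sum>i=1..?m. card (cycles (P i))) = \<Sum>{1..?m}"
    unfolding mlop_cost_def P_def[symmetric] sum.distrib[symmetric] using rank by (intro sum.cong) auto
  with 1 2 show ?thesis by linarith
qed

text \<open>Optimality of the shortest-processing-time rule: for each pair of cycles the one completed
  first contributes its length to the completion time of the other, so the pair contributes at
  least the smaller of both lengths, and exactly that if shorter cycles precede longer ones.\<close>

lemma sum_completion_times_le:
  fixes \<sigma> \<tau> :: "'a \<Rightarrow> nat" and pr :: "'a set \<Rightarrow> nat"
  assumes E: "finite E" and \<C>: "\<And>F. F \<in> \<C> \<Longrightarrow> F \<subseteq> E" "{} \<notin> \<C>" "pairwise disjnt \<C>"
    and \<sigma>: "bij_betw \<sigma> E {1..card E}" and \<tau>: "bij_betw \<tau> E {1..card E}"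
    and inj: "inj_on pr \<C>"
    and mono: "\<And>F G. F \<in> \<C> \<Longrightarrow> G \<in> \<C> \<Longrightarrow> pr F < pr G \<Longrightarrow> card F \<le> card G"
    and prefix: "\<And>F e. F \<in> \<C> \<Longrightarrow> e \<in> F \<Longrightarrow>
       {f \<in> E. \<sigma> f \<le> \<sigma> e} \<subseteq> \<Union>{G \<in> \<C>. pr G \<le> pr F}"
  shows "(\<Sum>F\<in>\<C>. Max (\<sigma> ` F)) \<le> (\<Sum>F\<in>\<C>. Max (\<tau> ` F))"
proof -
  have fin: "finite \<C>" using \<C>(1) E by (meson PowI finite_Pow_iff finite_subset subsetI)
  have finF: "finite F" if "F \<in> \<C>" for F using that \<C>(1) E finite_subset by blast
  have Max_in: "Max (\<rho> ` F) \<in> \<rho> ` F" if "F \<in> \<C>" for \<rho> :: "'a \<Rightarrow> nat" and F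
    using that finF \<C>(2) by (intro Max_in) auto
  have card_Union: "card (\<Union>{G \<in> \<C>. Q G}) = (\<Sum>G\<in>\<C>. if Q G then card G else 0)" for Q
  proof -
    have "card (\<Union>{G \<in> \<C>. Q G}) = (\<Sum>G\<in>{G \<in> \<C>. Q G}. card G)"
      using \<C>(3) finF by (intro card_Union_disjoint) (auto intro: pairwise_subset)
    then show ?thesis using fin by (simp add: sum.inter_filter)
  qed
  have card_prefix: "card {f \<in> E. \<rho> f \<le> Max (\<rho> ` F)} = Max (\<rho> ` F)"
    if "F \<in> \<C>" "bij_betw \<rho> E {1..card E}" for \<rho> F
  proof (rule card_bij_prefix[OF that(2)])
    have "Max (\<rho> ` F) \<in> \<rho> ` E" using Max_in[OF that(1), of \<rho>] \<C>(1)[OF that(1)] by blast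
    then show "Max (\<rho> ` F) \<le> card E" using that(2) by (simp add: bij_betw_def)
  qed
  \<comment> \<open>\<open>T F G\<close> counts edges of \<open>G\<close> that are certainly placed
    when \<open>F\<close> is completed under \<open>\<tau>\<close>; \<open>S F G\<close> is an
    allowance for \<open>G\<close> in the same role under \<open>\<sigma>\<close>. Summed over
    \<open>G\<close>, the former bounds a completion time from below and the latter from
    above.\<close>
  define T where "T F G = (if Max (\<tau> ` G) \<le> Max (\<tau> ` F) then card G else 0)" for F G
  define S where "S F G = (if pr G \<le> pr F then card G else 0)" for F G
  have \<tau>_ge: "(\<Sum>G\<in>\<C>. T F G) \<le> Max (\<tau> ` F)" if "F \<in> \<C>" for F
  proof -
    have "\<Union>{G \<in> \<C>. Max (\<tau> ` G) \<le> Max (\<tau> ` F)} \<subseteq> {f \<in> E. \<tau> f \<le> Max (\<tau> ` F)}"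
    proof clarify
      fix f G assume "f \<in> G" "G \<in> \<C>" "Max (\<tau> ` G) \<le> Max (\<tau> ` F)"
      moreover from this have "\<tau> f \<le> Max (\<tau> ` G)" using finF by simp
      ultimately show "f \<in> E \<and> \<tau> f \<le> Max (\<tau> ` F)" using \<C>(1) by auto
    qed
    moreover have "finite {f \<in> E. \<tau> f \<le> Max (\<tau> ` F)}" using E by simp
    ultimately have "card (\<Union>{G \<in> \<C>. Max (\<tau> ` G) \<le> Max (\<tau> ` F)})
        \<le> card {f \<in> E. \<tau> f \<le> Max (\<tau> ` F)}"
      by (rule card_mono[rotated])
    then show ?thesis
      by (simp only: T_def card_Union card_prefix[OF that \<tau>])
  qed
  have \<sigma>_le: "Max (\<sigma> ` F) \<le> (\<Sum>G\<in>\<C>. S F G)" if F: "F \<in> \<C>" for F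
  proof -
    obtain e where "e \<in> F" "Max (\<sigma> ` F) = \<sigma> e" using Max_in[OF F, of \<sigma>] by auto
    then have "{f \<in> E. \<sigma> f \<le> Max (\<sigma> ` F)} \<subseteq> \<Union>{G \<in> \<C>. pr G \<le> pr F}"
      using prefix[OF that] by auto
    moreover have "finite (\<Union>{G \<in> \<C>. pr G \<le> pr F})" using fin finF by auto
    ultimately have "card {f \<in> E. \<sigma> f \<le> Max (\<sigma> ` F)} \<le> card (\<Union>{G \<in> \<C>. pr G \<le> pr F})"
      by (rule card_mono[rotated])
    then show ?thesis
      by (simp only: S_def card_Union card_prefix[OF that \<sigma>])
  qed
  have "S F G + S G F \<le> T F G + T G F" if "F \<in> \<C>" "G \<in> \<C>" for F G
  proof (cases "F = G")
    case True
    then show ?thesis by (simp add: S_def T_def)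
  next
    case False
    then have "pr F < pr G \<or> pr G < pr F"
      using inj that by (metis inj_on_def linorder_neqE_nat)
    \<comment> \<open>Only one of the two comparisons of priorities holds, and \<open>mono\<close>
      makes the surviving term the smaller length. Under \<open>\<tau>\<close> at least one
      comparison holds, since completion times are linearly ordered.\<close>
    then have "S F G + S G F \<le> min (card F) (card G)"
      using mono that by (auto simp: S_def)
    also have "\<dots> \<le> T F G + T G F" by (auto simp: T_def)
    finally show ?thesis .
  qed
  then have "(\<Sum>F\<in>\<C>. \<Sum>G\<in>\<C>. S F G + S G F) \<le> (\<Sum>F\<in>\<C>. \<Sum>G\<in>\<C>. T F G + T G F)"
    by (intro sum_mono)
  \<comment> \<open>The inequality for pairs is summed over all ordered pairs; swapping the order of
    summation shows that each symmetrised sum is twice the original one.\<close>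
  moreover have "(\<Sum>F\<in>\<C>. \<Sum>G\<in>\<C>. U F G + U G F) = 2 * (\<Sum>F\<in>\<C>. \<Sum>G\<in>\<C>. U F G)"
    for U :: "'a set \<Rightarrow> 'a set \<Rightarrow> nat"
    using sum.swap[of U \<C> \<C>] by (simp add: sum.distrib)
  ultimately have "(\<Sum>F\<in>\<C>. \<Sum>G\<in>\<C>. S F G) \<le> (\<Sum>F\<in>\<C>. \<Sum>G\<in>\<C>. T F G)" by simp
  moreover have "(\<Sum>F\<in>\<C>. Max (\<sigma> ` F)) \<le> (\<Sum>F\<in>\<C>. \<Sum>G\<in>\<C>. S F G)"
    by (rule sum_mono) (rule \<sigma>_le)
  moreover have "(\<Sum>F\<in>\<C>. \<Sum>G\<in>\<C>. T F G) \<le> (\<Sum>F\<in>\<C>. Max (\<tau> ` F))"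
    by (rule sum_mono) (rule \<tau>_ge)
  ultimately show ?thesis by (meson order_trans)
qed

text \<open>The other terms of the cost identity are the same for all orderings, so only completion
  times are compared. The last hypothesis also keeps the bridges behind the cycles: a prefix ending
  at a cycle edge consists of cycle edges.\<close>

lemma mlop_solution_shortest_cycle_first:
  fixes pr :: "'a set set \<Rightarrow> nat"
  assumes E: "finite E" and dis: "pairwise disjnt (cycles E)" and \<sigma>: "bij_betw \<sigma> E {1..card E}"
    and "inj_on pr (cycles E)"
    and "\<And>F G. F \<in> cycles E \<Longrightarrow> G \<in> cycles E \<Longrightarrow> pr F < pr G \<Longrightarrow> card F \<le> card G"
    and "\<And>F e. F \<in> cycles E \<Longrightarrow> e \<in> F \<Longrightarrow>
       {f \<in> E. \<sigma> f \<le> \<sigma> e} \<subseteq> \<Union>{G \<in> cycles E. pr G \<le> pr F}"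
  shows "mlop_solution E \<sigma>"
  unfolding mlop_solution_def
proof (intro conjI allI impI)
  show "bij_betw \<sigma> E {1..card E}" by (rule \<sigma>)
  fix \<tau> assume \<tau>: "bij_betw \<tau> E {1..card E}"
  have "(\<Sum>F\<in>cycles E. Max (\<sigma> ` F)) \<le> (\<Sum>F\<in>cycles E. Max (\<tau> ` F))"
  proof (rule sum_completion_times_le[OF E _ _ dis \<sigma> \<tau>])
    show "{} \<notin> cycles E" using cycles_nonempty by blast
    show "F \<subseteq> E" if "F \<in> cycles E" for F using that by (simp add: cycles_def)
  qed (fact assms)+
  then show "mlop_cost E \<sigma> \<le> mlop_cost E \<tau>"
    using mlop_cost_completion_times[OF E dis \<sigma>] mlop_cost_completion_times[OF E dis \<tau>]
    by linarith
qed

section \<open>Verification of the program\<close>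

text \<open>Total correctness with an upper bound on the time instead of the exact number of steps,
  so that branches of different cost share one bound.\<close>

definition runs :: "com \<Rightarrow> state \<Rightarrow> nat \<Rightarrow> (state \<Rightarrow> bool) \<Rightarrow> bool" where
  "runs c s T Q \<longleftrightarrow> (\<exists>t s'. exec c s t s' \<and> t \<le> T \<and> Q s')"

lemma runs_mono: "runs c s T' Q' \<Longrightarrow> T' \<le> T \<Longrightarrow> (\<And>s'. Q' s' \<Longrightarrow> Q s') \<Longrightarrow> runs c s T Q"
  unfolding runs_def using order_trans by blast

lemma runs_le: "runs c s T' Q \<Longrightarrow> T' \<le> T \<Longrightarrow> runs c s T Q"
  by (rule runs_mono)

lemma runs_Skip: "Q s \<Longrightarrow> runs Skip s 1 Q"
  unfolding runs_def using exec.Skip by blast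

lemma runs_Assign:
  "Q (s(x := (s x)(aval a s := aval b s))) \<Longrightarrow> runs (Assign x a b) s (1 + acost a + acost b) Q"
  unfolding runs_def using exec.Assign by blast

lemma runs_Seq:
  assumes "runs c s T R" "\<And>s'. R s' \<Longrightarrow> runs d s' T' Q"
  shows "runs (Seq c d) s (1 + T + T') Q"
proof -
  obtain t s1 where 1: "exec c s t s1" "t \<le> T" "R s1" using assms(1) by (auto simp: runs_def)
  obtain t' s2 where 2: "exec d s1 t' s2" "t' \<le> T'" "Q s2"
    using assms(2)[OF 1(3)] by (auto simp: runs_def)
  show ?thesis
    unfolding runs_def using exec.Seq[OF 1(1) 2(1)] 1 2 by (intro exI conjI) auto
qed

lemma runs_Seq_Assign:
  "runs d (s(x := (s x)(aval a s := aval b s))) T Q \<Longrightarrow>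
     runs (Seq (Assign x a b) d) s (1 + (1 + acost a + acost b) + T) Q"
  by (rule runs_Seq[OF runs_Assign[where Q = "\<lambda>s'. s' = s(x := (s x)(aval a s := aval b s))"]]) auto

text \<open>Adding the bounds of the two branches, instead of taking their maximum, keeps the bounds
  polynomial expressions; the loss does not affect polynomiality.\<close>

lemma runs_Cond:
  assumes "bval b s \<Longrightarrow> runs c s T Q" "\<not> bval b s \<Longrightarrow> runs d s T' Q"
  shows "runs (Cond b c d) s (1 + bcost b + T + T') Q"
proof (cases "bval b s")
  case True
  then obtain t s' where "exec c s t s'" "t \<le> T" "Q s'" using assms(1) by (auto simp: runs_def)
  then show ?thesis
    unfolding runs_def using exec.CondTrue[OF True] by (intro exI conjI) auto
next
  case False
  then obtain t s' where "exec d s t s'" "t \<le> T'" "Q s'" using assms(2) by (auto simp: runs_def)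
  then show ?thesis
    unfolding runs_def using exec.CondFalse[OF False] by (intro exI conjI) auto
qed

abbreviation var :: "string \<Rightarrow> aexp" where
  "var x \<equiv> Cell x (Const 0)"

definition for_loop :: "string \<Rightarrow> string \<Rightarrow> com \<Rightarrow> com" where
  "for_loop x y c = Seq (Assign x (Const 0) (Const 0))
     (While (Less (var x) (var y)) (Seq c (Assign x (Const 0) (Add (var x) (Const 1)))))"

text \<open>The 13 extra steps per round are 6 for the test, 6 for the increment and 1 for the
  \<open>Seq\<close>; the final 10 are 3 for the initialisation, 1 for its \<open>Seq\<close> and 6
  for the failing test. The invariant speaks of the state whose counter is already \<open>k\<close>,
  hence the update of \<open>x\<close> in \<open>step\<close>.\<close>

lemma runs_for_loop:
  assumes y: "s y 0 = N" "x \<noteq> y"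
    and init: "I 0 (s(x := (s x)(0 := 0)))"
    and step: "\<And>k s. k < N \<Longrightarrow> I k s \<Longrightarrow> s x 0 = k \<Longrightarrow> s y 0 = N \<Longrightarrow>
      runs c s T (\<lambda>s'. s' x 0 = k \<and> s' y 0 = N \<and> I (Suc k) (s'(x := (s' x)(0 := Suc k))))"
  shows "runs (for_loop x y c) s (N * (T + 13) + 10) (I N)"
proof -
  let ?W = "While (Less (var x) (var y)) (Seq c (Assign x (Const 0) (Add (var x) (Const 1))))"
  have "runs ?W s ((N - k) * (T + 13) + 6) (I N)"
    if "k \<le> N" "I k s" "s x 0 = k" "s y 0 = N" for k s
    using that
  proof (induction "N - k" arbitrary: k s)
    case 0
    have "exec ?W s (1 + bcost (Less (var x) (var y))) s"
      using 0 by (intro exec.WhileFalse) simp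
    then show ?case
      unfolding runs_def using 0 by (intro exI[of _ s] exI conjI) auto
  next
    case (Suc d)
    then have k: "k < N" by simp
    obtain t s1 where 1: "exec c s t s1" "t \<le> T" "s1 x 0 = k" "s1 y 0 = N"
      "I (Suc k) (s1(x := (s1 x)(0 := Suc k)))"
      using step[OF k Suc.prems(2-4)] by (auto simp: runs_def)
    let ?s2 = "s1(x := (s1 x)(0 := Suc k))"
    have "exec (Assign x (Const 0) (Add (var x) (Const 1))) s1 6 ?s2"
      using exec.Assign[of x "Const 0" "Add (var x) (Const 1)" s1] 1
      by (simp add: eval_nat_numeral)
    from exec.Seq[OF 1(1) this]
    have 2: "exec (Seq c (Assign x (Const 0) (Add (var x) (Const 1)))) s (1 + t + 6) ?s2" .
    have "runs ?W ?s2 ((N - Suc k) * (T + 13) + 6) (I N)"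
      by (rule Suc.hyps(1)) (use Suc.hyps k 1 y in auto)
    then obtain t' s3 where 3: "exec ?W ?s2 t' s3" "t' \<le> (N - Suc k) * (T + 13) + 6" "I N s3"
      by (auto simp: runs_def)
    have b: "bval (Less (var x) (var y)) s" using Suc.prems k by simp
    have "N - k = Suc (N - Suc k)" using k by simp
    then have "1 + bcost (Less (var x) (var y)) + (1 + t + 6) + t' \<le> (N - k) * (T + 13) + 6"
      using 1(2) 3(2) by simp
    then show ?case
      unfolding runs_def using exec.WhileTrue[OF b 2 3(1)] 3(3) by blast
  qed
  from this[of 0 "s(x := (s x)(0 := 0))"]
  have "runs ?W (s(x := (s x)(0 := 0))) (N * (T + 13) + 6) (I N)" using init y by simp
  from runs_Seq_Assign[of _ s x "Const 0" "Const 0", simplified, OF this] show ?thesis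
    unfolding for_loop_def by (rule runs_mono) auto
qed

definition frame :: "string set \<Rightarrow> state \<Rightarrow> state \<Rightarrow> bool" where
  "frame X s s' \<longleftrightarrow> (\<forall>z. z \<notin> X \<longrightarrow> s' z = s z)"

section \<open>Connected components by repeated relabelling\<close>

definition init_comp :: com where
  "init_comp = for_loop ''x'' ''n'' (Assign ''comp'' (var ''x'') (var ''x''))"

lemma runs_init_comp:
  assumes "s ''n'' 0 = N"
  shows "runs init_comp s (18 * N + 10)
    (\<lambda>s'. (\<forall>y<N. s' ''comp'' y = y) \<and> frame {''x'', ''comp''} s s')"
proof -
  define I where "I k s' \<longleftrightarrow> (\<forall>y<k. s' ''comp'' y = y) \<and> frame {''x'', ''comp''} s s'" for k s'
  have "runs init_comp s (N * (5 + 13) + 10) (I N)"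
    unfolding init_comp_def
  proof (rule runs_for_loop)
    fix k s1 assume "k < N" "I k s1" "s1 ''x'' 0 = k" "s1 ''n'' 0 = N"
    then show "runs (Assign ''comp'' (var ''x'') (var ''x'')) s1 5 (\<lambda>s'. s' ''x'' 0 = k \<and> s' ''n'' 0 = N
        \<and> I (Suc k) (s'(''x'' := (s' ''x'')(0 := Suc k))))"
      by (intro runs_le[OF runs_Assign]) (auto simp: I_def frame_def)
  qed (use assms in \<open>auto simp: I_def frame_def\<close>)
  then show ?thesis by (rule runs_mono) (auto simp: I_def)
qed

definition relabel :: com where
  "relabel = for_loop ''x'' ''n''
     (Cond (Eq (Cell ''comp'' (var ''x'')) (var ''a'')) (Assign ''comp'' (var ''x'') (var ''b'')) Skip)"

lemma runs_relabel:
  assumes "s ''n'' 0 = N"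
  shows "runs relabel s (26 * N + 10)
    (\<lambda>s'. (\<forall>y. s' ''comp'' y = (if y < N \<and> s ''comp'' y = s ''a'' 0 then s ''b'' 0 else s ''comp'' y))
       \<and> frame {''x'', ''comp''} s s')"
proof -
  \<comment> \<open>The invariant compares with the labels of the initial state \<open>s\<close>:
    each cell is visited once, so a cell not yet visited still holds its old label.\<close>
  define I where "I k s' \<longleftrightarrow> (\<forall>y. s' ''comp'' y =
      (if y < k \<and> s ''comp'' y = s ''a'' 0 then s ''b'' 0 else s ''comp'' y))
    \<and> frame {''x'', ''comp''} s s'" for k s'
  have "runs relabel s (N * (13 + 13) + 10) (I N)"
    unfolding relabel_def
  proof (rule runs_for_loop)
    fix k s1 assume "k < N" "I k s1" "s1 ''x'' 0 = k" "s1 ''n'' 0 = N"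
    then show "runs (Cond (Eq (Cell ''comp'' (var ''x'')) (var ''a''))
        (Assign ''comp'' (var ''x'') (var ''b'')) Skip) s1 13 (\<lambda>s'. s' ''x'' 0 = k \<and> s' ''n'' 0 = N
        \<and> I (Suc k) (s'(''x'' := (s' ''x'')(0 := Suc k))))"
      by (intro runs_le[OF runs_Cond[OF runs_Assign runs_Skip]])
        (auto simp: I_def frame_def less_Suc_eq)
  qed (use assms in \<open>auto simp: I_def frame_def\<close>)
  then show ?thesis by (rule runs_mono) (auto simp: I_def)
qed

text \<open>Both labels are copied beforehand because \<open>relabel\<close> overwrites the very
  cell from which \<open>a\<close> is read.\<close>

definition unite :: com where
  "unite = Seq (Assign ''a'' (Const 0) (Cell ''comp'' (Cell ''u'' (var ''k''))))
     (Seq (Assign ''b'' (Const 0) (Cell ''comp'' (Cell ''v'' (var ''k'')))) relabel)"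

lemma runs_unite:
  assumes "s ''n'' 0 = N" "s ''k'' 0 = k"
  shows "runs unite s (26 * N + 24)
    (\<lambda>s'. (\<forall>y. s' ''comp'' y = (if y < N \<and> s ''comp'' y = s ''comp'' (s ''u'' k)
         then s ''comp'' (s ''v'' k) else s ''comp'' y))
       \<and> frame {''x'', ''comp'', ''a'', ''b''} s s')"
  unfolding unite_def
  by (rule runs_mono[OF runs_Seq_Assign[OF runs_Seq_Assign[OF runs_relabel[where N = N]]]])
    (use assms in \<open>auto simp: frame_def\<close>)

definition edge_at :: "'a list \<Rightarrow> (nat \<times> nat) list \<Rightarrow> nat \<Rightarrow> 'a set" where
  "edge_at vs ps k = decode_edge vs (ps ! k)"

definition loaded :: "'a list \<Rightarrow> (nat \<times> nat) list \<Rightarrow> state \<Rightarrow> bool" where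
  "loaded vs ps s \<longleftrightarrow> s ''n'' 0 = length vs \<and> s ''m'' 0 = length ps \<and>
     (\<forall>k<length ps. s ''u'' k = fst (ps ! k) \<and> s ''v'' k = snd (ps ! k))"

lemma loaded_frame:
  "loaded vs ps s \<Longrightarrow> frame X s s' \<Longrightarrow> X \<inter> {''n'', ''m'', ''u'', ''v''} = {} \<Longrightarrow> loaded vs ps s'"
  unfolding loaded_def frame_def by auto

definition components :: com where
  "components = Seq init_comp (for_loop ''k'' ''m''
     (Cond (Conj (Neg (Eq (var ''k'') (var ''i''))) (Neg (Eq (var ''k'') (var ''j'')))) unite Skip))"

definition labels_components :: "'a list \<Rightarrow> 'a set set \<Rightarrow> (nat \<Rightarrow> nat) \<Rightarrow> bool" where
  "labels_components vs E l \<longleftrightarrow>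
     (\<forall>x<length vs. \<forall>y<length vs. l x = l y \<longleftrightarrow> linked E (vs ! x) (vs ! y))"

text \<open>Giving the class of \<open>a\<close> the label of \<open>b\<close> merges the two
  classes, which is the right-hand side of \<open>linked_insert_iff\<close> read in terms of
  labels.\<close>

lemma labels_components_insert:
  assumes "labels_components vs E l" "a < length vs" "b < length vs"
    and "\<And>y. l' y = (if y < length vs \<and> l y = l a then l b else l y)"
  shows "labels_components vs (insert {vs ! a, vs ! b} E) l'"
  unfolding labels_components_def
proof (intro allI impI)
  fix x y assume xy: "x < length vs" "y < length vs"
  have l: "linked E (vs ! x) (vs ! y) \<longleftrightarrow> l x = l y" if "x < length vs" "y < length vs" for x y
    using assms(1) that by (auto simp: labels_components_def)
  show "l' x = l' y \<longleftrightarrow> linked (insert {vs ! a, vs ! b} E) (vs ! x) (vs ! y)"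
    unfolding linked_insert_iff using assms(2-4) xy by (auto simp: l)
qed

lemma runs_components:
  fixes vs :: "'a list"
  assumes s: "loaded vs ps s" "s ''i'' 0 = i" "s ''j'' 0 = j" and vs: "distinct vs"
    and ps: "\<forall>p\<in>set ps. fst p < length vs \<and> snd p < length vs"
  shows "runs components s (18 * length vs + 21 + length ps * (26 * length vs + 52))
    (\<lambda>s'. labels_components vs (edge_at vs ps ` ({..<length ps} - {i, j})) (s' ''comp'')
       \<and> frame {''x'', ''comp'', ''a'', ''b'', ''k''} s s')"
proof -
  define I where "I k s' \<longleftrightarrow> labels_components vs (edge_at vs ps ` ({..<k} - {i, j})) (s' ''comp'')
       \<and> frame {''x'', ''comp'', ''a'', ''b'', ''k''} s s'" for k s'
  have "runs components s (1 + (18 * length vs + 10) + (length ps * ((26 * length vs + 39) + 13) + 10))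
      (I (length ps))"
    unfolding components_def
  proof (rule runs_Seq[OF runs_init_comp])
    show "s ''n'' 0 = length vs" using s by (simp add: loaded_def)
    fix s1 assume s1: "(\<forall>y<length vs. s1 ''comp'' y = y) \<and> frame {''x'', ''comp''} s s1"
    show "runs (for_loop ''k'' ''m''
     (Cond (Conj (Neg (Eq (var ''k'') (var ''i''))) (Neg (Eq (var ''k'') (var ''j'')))) unite Skip)) s1
      (length ps * ((26 * length vs + 39) + 13) + 10) (I (length ps))"
    proof (rule runs_for_loop)
      show "s1 ''m'' 0 = length ps" using s s1 by (simp add: loaded_def frame_def)
      show "I 0 (s1(''k'' := (s1 ''k'')(0 := 0)))"
        using s1 vs by (auto simp: I_def frame_def labels_components_def linked_empty_iff
            nth_eq_iff_index_eq)
      fix k s2 assume k: "k < length ps" and I: "I k s2" "s2 ''k'' 0 = k" "s2 ''m'' 0 = length ps"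
      have frame: "frame {''x'', ''comp'', ''a'', ''b'', ''k''} s s2"
        and lab: "labels_components vs (edge_at vs ps ` ({..<k} - {i, j})) (s2 ''comp'')"
        using I(1) by (auto simp: I_def)
      have ij: "s2 ''i'' 0 = i" "s2 ''j'' 0 = j" and n: "s2 ''n'' 0 = length vs"
        and uv: "s2 ''u'' k = fst (ps ! k)" "s2 ''v'' k = snd (ps ! k)"
        using s frame k by (auto simp: frame_def loaded_def)
      have uv_lt: "fst (ps ! k) < length vs" "snd (ps ! k) < length vs" using ps k by auto
      have skip: "{..<Suc k} - {i, j} = {..<k} - {i, j}" if "k = i \<or> k = j"
        using that by (auto simp: less_Suc_eq)
      have ins: "edge_at vs ps ` ({..<Suc k} - {i, j}) =
          insert {vs ! fst (ps ! k), vs ! snd (ps ! k)} (edge_at vs ps ` ({..<k} - {i, j}))"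
        if "k \<noteq> i" "k \<noteq> j"
        using that by (simp add: lessThan_Suc insert_Diff_if edge_at_def decode_edge_def)
      show "runs (Cond (Conj (Neg (Eq (var ''k'') (var ''i''))) (Neg (Eq (var ''k'') (var ''j''))))
          unite Skip) s2 (26 * length vs + 39) (\<lambda>s'. s' ''k'' 0 = k \<and> s' ''m'' 0 = length ps \<and>
             I (Suc k) (s'(''k'' := (s' ''k'')(0 := Suc k))))"
      proof (rule runs_mono[OF runs_Cond[OF runs_mono[OF runs_unite[where s = s2, OF n I(2)] order_refl]
              runs_Skip]])
        fix s3
        assume b: "bval (Conj (Neg (Eq (var ''k'') (var ''i''))) (Neg (Eq (var ''k'') (var ''j'')))) s2"
        assume s3: "(\<forall>y. s3 ''comp'' y = (if y < length vs \<and> s2 ''comp'' y = s2 ''comp'' (s2 ''u'' k)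
         then s2 ''comp'' (s2 ''v'' k) else s2 ''comp'' y))
          \<and> frame {''x'', ''comp'', ''a'', ''b''} s2 s3"
        have "labels_components vs (insert {vs ! fst (ps ! k), vs ! snd (ps ! k)}
            (edge_at vs ps ` ({..<k} - {i, j}))) (s3 ''comp'')"
          by (rule labels_components_insert[OF lab uv_lt]) (use s3 uv in simp)
        then show "s3 ''k'' 0 = k \<and> s3 ''m'' 0 = length ps \<and>
             I (Suc k) (s3(''k'' := (s3 ''k'')(0 := Suc k)))"
          using s3 b I ij ins frame by (auto simp: I_def frame_def)
      next
        assume "\<not> bval (Conj (Neg (Eq (var ''k'') (var ''i''))) (Neg (Eq (var ''k'') (var ''j'')))) s2"
        then show "s2 ''k'' 0 = k \<and> s2 ''m'' 0 = length ps \<and>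
             I (Suc k) (s2(''k'' := (s2 ''k'')(0 := Suc k)))"
          using I ij skip lab frame by (auto simp: I_def frame_def)
      qed auto
    qed auto
  qed
  then show ?thesis by (rule runs_mono) (auto simp: I_def)
qed

text \<open>For the \<open>i\<close>-th edge of a cactus on a cycle this is the set of (indices of) edges of that
  cycle; for a bridge it is the set of all edges.\<close>

definition companions :: "'a list \<Rightarrow> (nat \<times> nat) list \<Rightarrow> nat \<Rightarrow> nat set" where
  "companions vs ps i = {j. j < length ps \<and> (i = j \<or>
     \<not> linked (edge_at vs ps ` ({..<length ps} - {i, j})) (vs ! fst (ps ! i)) (vs ! snd (ps ! i)))}"

text \<open>Lexicographic comparison by size and largest element, encoded as one number.\<close>

definition code :: "nat \<Rightarrow> nat set \<Rightarrow> nat" where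
  "code m X = card X * m + Max X"

text \<open>The machine cannot multiply, so \<open>w\<close> grows by \<open>m\<close> with every
  companion found. As \<open>j\<close> runs upwards, the last write to \<open>key\<close> adds the
  largest companion, and the result is the \<open>code\<close> of the whole set. The negated
  conjunction stands for a disjunction.\<close>

definition key_step :: com where
  "key_step = Seq components
     (Cond (Neg (Conj (Neg (Eq (var ''i'') (var ''j'')))
         (Eq (Cell ''comp'' (Cell ''u'' (var ''i''))) (Cell ''comp'' (Cell ''v'' (var ''i''))))))
       (Seq (Assign ''w'' (Const 0) (Add (var ''w'') (var ''m'')))
         (Assign ''key'' (var ''i'') (Add (var ''w'') (var ''j'')))) Skip)"

lemma runs_key_step:
  fixes vs :: "'a list"
  assumes s: "loaded vs ps s" "s ''i'' 0 = i" "s ''j'' 0 = j" and vs: "distinct vs"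
    and ps: "\<forall>p\<in>set ps. fst p < length vs \<and> snd p < length vs"
    and ij: "i < length ps" "j < length ps"
  shows "runs key_step s (18 * length vs + 60 + length ps * (26 * length vs + 52))
    (\<lambda>s'. s' ''w'' 0 = (if j \<in> companions vs ps i then s ''w'' 0 + length ps else s ''w'' 0)
       \<and> s' ''key'' = (if j \<in> companions vs ps i
           then (s ''key'')(i := s ''w'' 0 + length ps + j) else s ''key'')
       \<and> frame {''x'', ''comp'', ''a'', ''b'', ''k'', ''w'', ''key''} s s')"
proof (rule runs_mono)
  show "runs key_step s (1 + (18 * length vs + 21 + length ps * (26 * length vs + 52)) + 38)
    (\<lambda>s'. s' ''w'' 0 = (if j \<in> companions vs ps i then s ''w'' 0 + length ps else s ''w'' 0)
       \<and> s' ''key'' = (if j \<in> companions vs ps i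
           then (s ''key'')(i := s ''w'' 0 + length ps + j) else s ''key'')
       \<and> frame {''x'', ''comp'', ''a'', ''b'', ''k'', ''w'', ''key''} s s')"
    unfolding key_step_def
  proof (rule runs_Seq[OF runs_components[OF s vs ps]])
    fix s1
    assume s1: "labels_components vs (edge_at vs ps ` ({..<length ps} - {i, j})) (s1 ''comp'')
       \<and> frame {''x'', ''comp'', ''a'', ''b'', ''k''} s s1"
    have frame: "frame {''x'', ''comp'', ''a'', ''b'', ''k''} s s1" using s1 by simp
    have s1': "s1 ''i'' 0 = i" "s1 ''j'' 0 = j" "s1 ''m'' 0 = length ps" "s1 ''w'' = s ''w''"
      "s1 ''key'' = s ''key''" "s1 ''u'' i = fst (ps ! i)" "s1 ''v'' i = snd (ps ! i)"
      using s frame ij by (auto simp: frame_def loaded_def)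
    have "fst (ps ! i) < length vs" "snd (ps ! i) < length vs" using ps ij by auto
    then have *: "j \<in> companions vs ps i \<longleftrightarrow>
        i = j \<or> s1 ''comp'' (fst (ps ! i)) \<noteq> s1 ''comp'' (snd (ps ! i))"
      using s1 ij by (auto simp: companions_def labels_components_def)
    show "runs (Cond (Neg (Conj (Neg (Eq (var ''i'') (var ''j'')))
         (Eq (Cell ''comp'' (Cell ''u'' (var ''i''))) (Cell ''comp'' (Cell ''v'' (var ''i''))))))
       (Seq (Assign ''w'' (Const 0) (Add (var ''w'') (var ''m'')))
         (Assign ''key'' (var ''i'') (Add (var ''w'') (var ''j'')))) Skip) s1 38
     (\<lambda>s'. s' ''w'' 0 = (if j \<in> companions vs ps i then s ''w'' 0 + length ps else s ''w'' 0)
       \<and> s' ''key'' = (if j \<in> companions vs ps i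
           then (s ''key'')(i := s ''w'' 0 + length ps + j) else s ''key'')
       \<and> frame {''x'', ''comp'', ''a'', ''b'', ''k'', ''w'', ''key''} s s')"
      by (rule runs_le[OF runs_Cond[OF runs_Seq_Assign[OF runs_Assign] runs_Skip]])
        (use s1' * frame in \<open>auto simp: frame_def\<close>)
  qed
qed auto

definition compute_keys :: com where
  "compute_keys = for_loop ''i'' ''m'' (Seq (Assign ''w'' (Const 0) (Const 0)) (for_loop ''j'' ''m'' key_step))"

lemma runs_compute_keys:
  fixes vs :: "'a list"
  assumes s: "loaded vs ps s" and vs: "distinct vs"
    and ps: "\<forall>p\<in>set ps. fst p < length vs \<and> snd p < length vs"
  shows "runs compute_keys s (length ps * ((length ps *
        (18 * length vs + 73 + length ps * (26 * length vs + 52)) + 14) + 13) + 10)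
    (\<lambda>s'. (\<forall>i<length ps. s' ''key'' i = code (length ps) (companions vs ps i))
       \<and> s' ''m'' = s ''m'')"
proof -
  let ?X = "{''x'', ''comp'', ''a'', ''b'', ''k'', ''w'', ''key'', ''i'', ''j''}"
  let ?T = "18 * length vs + 60 + length ps * (26 * length vs + 52)"
  define I where "I i s' \<longleftrightarrow> (\<forall>i'<i. s' ''key'' i' = code (length ps) (companions vs ps i'))
       \<and> frame ?X s s'" for i s'
  define part where "part i j = companions vs ps i \<inter> {..<j}" for i j
  have part_Suc: "part i (Suc j) = (if j \<in> companions vs ps i then insert j (part i j) else part i j)" for i j
    by (auto simp: part_def less_Suc_eq)
  \<comment> \<open>Before the first companion is met, \<open>key\<close> holds no meaningful value
    and the maximum of the empty set is unspecified, so the last conjunct is conditional. At the end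
    its premise holds because \<open>i\<close> is its own companion.\<close>
  define J where "J i j s' \<longleftrightarrow> I i s' \<and> s' ''i'' 0 = i \<and> s' ''w'' 0 = card (part i j) * length ps \<and>
     (part i j \<noteq> {} \<longrightarrow> s' ''key'' i = code (length ps) (part i j))" for i j s'
  have I_frame: "I i s2" if "I i s1" "frame ?X s1 s2" "\<forall>i'<i. s2 ''key'' i' = s1 ''key'' i'" for i s1 s2
    using that by (auto simp: I_def frame_def)
  have J_step: "J i (Suc j) (s2(''j'' := f))"
    if J: "J i j s1" and "j < length ps" and i: "s2 ''i'' 0 = i"
      and w: "s2 ''w'' 0 = (if j \<in> companions vs ps i then s1 ''w'' 0 + length ps else s1 ''w'' 0)"
      and key: "s2 ''key'' = (if j \<in> companions vs ps i
           then (s1 ''key'')(i := s1 ''w'' 0 + length ps + j) else s1 ''key'')"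
      and frame: "frame {''x'', ''comp'', ''a'', ''b'', ''k'', ''w'', ''key''} s1 s2"
    for i j s1 s2 f
  proof -
    have "I i (s2(''j'' := f))"
      by (rule I_frame[of _ s1]) (use J key frame in \<open>auto simp: J_def frame_def\<close>)
    moreover have "j \<notin> part i j" "finite (part i j)" "\<forall>x\<in>part i j. x < j" by (auto simp: part_def)
    moreover from this have "Max (insert j (part i j)) = j" by (intro Max_eqI) auto
    ultimately show ?thesis
      using J w key i unfolding J_def by (auto simp: part_Suc code_def)
  qed
  have "runs compute_keys s (length ps * ((1 + (1 + acost (Const 0) + acost (Const 0)) +
      (length ps * (?T + 13) + 10)) + 13) + 10) (I (length ps))"
    unfolding compute_keys_def
  proof (rule runs_for_loop)
    show "s ''m'' 0 = length ps" using s by (simp add: loaded_def)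
    show "I 0 (s(''i'' := (s ''i'')(0 := 0)))" by (auto simp: I_def frame_def)
    fix i s1 assume i: "i < length ps" and I: "I i s1" "s1 ''i'' 0 = i" "s1 ''m'' 0 = length ps"
    show "runs (Seq (Assign ''w'' (Const 0) (Const 0)) (for_loop ''j'' ''m'' key_step)) s1
      (1 + (1 + acost (Const 0) + acost (Const 0)) + (length ps * (?T + 13) + 10))
      (\<lambda>s'. s' ''i'' 0 = i \<and> s' ''m'' 0 = length ps \<and> I (Suc i) (s'(''i'' := (s' ''i'')(0 := Suc i))))"
    proof (rule runs_Seq_Assign, rule runs_mono[OF runs_for_loop[where I = "J i"]])
      show "J i 0 ((s1(''w'' := (s1 ''w'')(aval (Const 0) s1 := aval (Const 0) s1)))
         (''j'' := ((s1(''w'' := (s1 ''w'')(aval (Const 0) s1 := aval (Const 0) s1))) ''j'')(0 := 0)))"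
        using I by (auto simp: J_def part_def I_def frame_def)
      fix j s2 assume j: "j < length ps" and J: "J i j s2" "s2 ''j'' 0 = j" "s2 ''m'' 0 = length ps"
      have frame: "frame ?X s s2" using J by (simp add: J_def I_def)
      have ld: "loaded vs ps s2" by (rule loaded_frame[OF s frame]) auto
      have i2: "s2 ''i'' 0 = i" using J by (simp add: J_def)
      show "runs key_step s2 ?T (\<lambda>s'. s' ''j'' 0 = j \<and> s' ''m'' 0 = length ps \<and>
          J i (Suc j) (s'(''j'' := (s' ''j'')(0 := Suc j))))"
      proof (rule runs_mono[OF runs_key_step[OF ld i2 J(2) vs ps i j] order_refl], elim conjE, intro conjI)
        fix s3
        assume s3: "s3 ''w'' 0 = (if j \<in> companions vs ps i then s2 ''w'' 0 + length ps else s2 ''w'' 0)"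
          "s3 ''key'' = (if j \<in> companions vs ps i
           then (s2 ''key'')(i := s2 ''w'' 0 + length ps + j) else s2 ''key'')"
          "frame {''x'', ''comp'', ''a'', ''b'', ''k'', ''w'', ''key''} s2 s3"
        show "s3 ''j'' 0 = j" "s3 ''m'' 0 = length ps" using s3(3) J by (auto simp: frame_def)
        have "s3 ''i'' 0 = i" using s3(3) i2 by (auto simp: frame_def)
        then show "J i (Suc j) (s3(''j'' := (s3 ''j'')(0 := Suc j)))"
          by (intro J_step[OF J(1) j _ s3])
      qed
    next
      fix s2 assume J: "J i (length ps) s2"
      have part: "part i (length ps) = companions vs ps i" by (auto simp: part_def companions_def)
      have "i \<in> companions vs ps i" using i by (simp add: companions_def)
      then have "s2 ''key'' i = code (length ps) (companions vs ps i)"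
        using J by (auto simp: J_def part)
      then show "s2 ''i'' 0 = i \<and> s2 ''m'' 0 = length ps \<and> I (Suc i) (s2(''i'' := (s2 ''i'')(0 := Suc i)))"
        using J s by (auto simp: J_def I_def frame_def less_Suc_eq loaded_def)
    qed (use I in auto)
  qed auto
  then show ?thesis by (rule runs_mono) (auto simp: I_def frame_def)
qed

section \<open>Sorting by counting predecessors\<close>

definition precedes :: "(nat \<Rightarrow> nat) \<Rightarrow> nat \<Rightarrow> nat \<Rightarrow> bool" where
  "precedes key j i \<longleftrightarrow> key j < key i \<or> key j = key i \<and> j < i"

definition position :: "nat \<Rightarrow> (nat \<Rightarrow> nat) \<Rightarrow> nat \<Rightarrow> nat" where
  "position m key i = Suc (card {j. j < m \<and> precedes key j i})"

definition order_by_keys :: com where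
  "order_by_keys = for_loop ''i'' ''m'' (Seq (Assign ''sigma'' (var ''i'') (Const 1))
     (for_loop ''j'' ''m''
       (Cond (Neg (Conj (Neg (Less (Cell ''key'' (var ''j'')) (Cell ''key'' (var ''i''))))
           (Neg (Conj (Eq (Cell ''key'' (var ''j'')) (Cell ''key'' (var ''i'')))
             (Less (var ''j'') (var ''i''))))))
         (Assign ''sigma'' (var ''i'') (Add (Cell ''sigma'' (var ''i'')) (Const 1))) Skip)))"

lemma runs_order_by_keys:
  assumes s: "s ''m'' 0 = m"
  shows "runs order_by_keys s (m * (m * 55 + 30) + 10)
    (\<lambda>s'. \<forall>i<m. s' ''sigma'' i = position m (s ''key'') i)"
proof -
  let ?X = "{''sigma'', ''i'', ''j''}"
  define I where "I i s' \<longleftrightarrow> (\<forall>i'<i. s' ''sigma'' i' = position m (s ''key'') i') \<and> frame ?X s s'" for i s'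
  define part where "part i j = {j'. j' < j \<and> precedes (s ''key'') j' i}" for i j
  have part_Suc: "card (part i (Suc j)) = (if precedes (s ''key'') j i then Suc (card (part i j)) else card (part i j))"
    for i j
  proof -
    have "part i (Suc j) = (if precedes (s ''key'') j i then insert j (part i j) else part i j)"
      by (auto simp: part_def less_Suc_eq)
    then show ?thesis by (simp add: part_def)
  qed
  define J where "J i j s' \<longleftrightarrow> I i s' \<and> s' ''i'' 0 = i \<and> s' ''sigma'' i = Suc (card (part i j))" for i j s'
  have "runs order_by_keys s (m * ((1 + (1 + acost (var ''i'') + acost (Const 1)) + (m * (42 + 13) + 10)) + 13) + 10) (I m)"
    unfolding order_by_keys_def
  proof (rule runs_for_loop)
    show "s ''m'' 0 = m" by (rule s)
    show "I 0 (s(''i'' := (s ''i'')(0 := 0)))" by (auto simp: I_def frame_def)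
    fix i s1 assume i: "i < m" and I: "I i s1" "s1 ''i'' 0 = i" "s1 ''m'' 0 = m"
    show "runs (Seq (Assign ''sigma'' (var ''i'') (Const 1))
     (for_loop ''j'' ''m''
       (Cond (Neg (Conj (Neg (Less (Cell ''key'' (var ''j'')) (Cell ''key'' (var ''i''))))
           (Neg (Conj (Eq (Cell ''key'' (var ''j'')) (Cell ''key'' (var ''i'')))
             (Less (var ''j'') (var ''i''))))))
         (Assign ''sigma'' (var ''i'') (Add (Cell ''sigma'' (var ''i'')) (Const 1))) Skip))) s1
      (1 + (1 + acost (var ''i'') + acost (Const 1)) + (m * (42 + 13) + 10))
      (\<lambda>s'. s' ''i'' 0 = i \<and> s' ''m'' 0 = m \<and> I (Suc i) (s'(''i'' := (s' ''i'')(0 := Suc i))))"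
    proof (rule runs_Seq_Assign, rule runs_mono[OF runs_for_loop[where I = "J i"]])
      let ?s = "s1(''sigma'' := (s1 ''sigma'')(aval (var ''i'') s1 := aval (Const 1) s1))"
      show "J i 0 (?s(''j'' := (?s ''j'')(0 := 0)))"
        using I by (auto simp: J_def part_def I_def frame_def)
      fix j s2 assume j: "j < m" and J: "J i j s2" "s2 ''j'' 0 = j" "s2 ''m'' 0 = m"
      show "runs (Cond (Neg (Conj (Neg (Less (Cell ''key'' (var ''j'')) (Cell ''key'' (var ''i''))))
           (Neg (Conj (Eq (Cell ''key'' (var ''j'')) (Cell ''key'' (var ''i'')))
             (Less (var ''j'') (var ''i''))))))
         (Assign ''sigma'' (var ''i'') (Add (Cell ''sigma'' (var ''i'')) (Const 1))) Skip) s2 42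
          (\<lambda>s'. s' ''j'' 0 = j \<and> s' ''m'' 0 = m \<and> J i (Suc j) (s'(''j'' := (s' ''j'')(0 := Suc j))))"
        by (rule runs_le[OF runs_Cond[OF runs_Assign runs_Skip]])
          (use J in \<open>auto simp: J_def I_def frame_def part_Suc precedes_def\<close>)
    next
      fix s2 assume "J i m s2"
      then show "s2 ''i'' 0 = i \<and> s2 ''m'' 0 = m \<and> I (Suc i) (s2(''i'' := (s2 ''i'')(0 := Suc i)))"
        using s by (auto simp: J_def I_def frame_def less_Suc_eq position_def part_def)
    qed (use I in auto)
  qed auto
  then show ?thesis by (rule runs_mono) (auto simp: I_def)
qed

section \<open>Optimality of the computed ordering\<close>

text \<open>Edge numbers break ties, so \<open>precedes\<close> is a strict linear order and the
  sets of predecessors grow strictly along it. The positions are thus distinct numbers in a range of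
  size \<open>m\<close>.\<close>

lemma bij_betw_position: "bij_betw (position m key) {..<m} {1..m}"
proof -
  have less: "position m key k < position m key l" if "precedes key k l" "k < m" for k l
  proof -
    have "{j. j < m \<and> precedes key j k} \<subset> {j. j < m \<and> precedes key j l}"
      using that by (auto simp: precedes_def)
    then show ?thesis unfolding position_def by (simp add: psubset_card_mono)
  qed
  have inj: "inj_on (position m key) {..<m}"
  proof (rule inj_onI)
    fix k l assume "k \<in> {..<m}" "l \<in> {..<m}" "position m key k = position m key l"
    then have "\<not> precedes key k l" "\<not> precedes key l k" using less[of k l] less[of l k] by auto
    then show "k = l" unfolding precedes_def by linarith
  qed
  have "position m key k \<le> m" if "k < m" for k
  proof -
    have "card {j. j < m \<and> precedes key j k} < card {..<m}"
      by (rule psubset_card_mono) (use that in \<open>auto simp: precedes_def\<close>)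
    then show ?thesis by (simp add: position_def)
  qed
  then have "position m key ` {..<m} \<subseteq> {1..m}" by (auto simp: position_def)
  moreover have "card (position m key ` {..<m}) = card {1..m}" using card_image[OF inj] by simp
  ultimately have "position m key ` {..<m} = {1..m}" by (simp add: card_subset_eq)
  with inj show ?thesis by (simp add: bij_betw_def)
qed

lemma position_le_imp_key_le:
  assumes "position m key k \<le> position m key l" "l < m"
  shows "key k \<le> key l"
proof (rule ccontr)
  assume "\<not> key k \<le> key l"
  then have "l \<in> {j. j < m \<and> precedes key j k}" "l \<notin> {j. j < m \<and> precedes key j l}"
    and "\<And>j. precedes key j l \<Longrightarrow> precedes key j k"
    using assms(2) unfolding precedes_def by simp_all linarith
  then have "{j. j < m \<and> precedes key j l} \<subset> {j. j < m \<and> precedes key j k}" by blast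
  then have "position m key l < position m key k"
    unfolding position_def by (simp add: psubset_card_mono)
  with assms(1) show False by simp
qed

lemma Max_lt_bound: "X \<subseteq> {..<m} \<Longrightarrow> X \<noteq> {} \<Longrightarrow> Max X < (m::nat)"
  by (metis Max_in finite_lessThan finite_subset lessThan_iff subsetD)

text \<open>As \<open>Max Y < m\<close>, one additional element outweighs any difference between the
  maxima.\<close>

lemma code_less_imp_card_le:
  assumes "code m X < code m Y" "Y \<subseteq> {..<m}" "Y \<noteq> {}"
  shows "card X \<le> card Y"
proof (rule ccontr)
  assume "\<not> card X \<le> card Y"
  then have "Suc (card Y) * m \<le> card X * m" by (intro mult_right_mono) auto
  then show False using assms(1) Max_lt_bound[OF assms(2,3)] by (simp add: code_def)
qed

text \<open>Reduction modulo \<open>m\<close> recovers the maximum.\<close>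

lemma code_eq_imp_Max_eq:
  assumes "code m X = code m Y" "X \<subseteq> {..<m}" "X \<noteq> {}" "Y \<subseteq> {..<m}" "Y \<noteq> {}"
  shows "Max X = Max Y"
proof -
  have "code m X mod m = code m Y mod m" using assms(1) by simp
  then show ?thesis
    using Max_lt_bound[OF assms(2,3)] Max_lt_bound[OF assms(4,5)] by (simp add: code_def)
qed

text \<open>The priority \<open>pr\<close> of a cycle is the key that all its edges share. Equal
  priorities force equal largest indices, hence a common edge and the same cycle.\<close>

lemma cactus_keys_give_solution:
  fixes vs :: "'a list"
  assumes G: "simple_graph V E" "cactus V E" and pres: "presents vs ps V E"
    and \<sigma>: "\<And>k. k < length ps \<Longrightarrow> \<sigma> (edge_at vs ps k) = position (length ps) key k"
    and key: "\<And>i. i < length ps \<Longrightarrow> key i = code (length ps) (companions vs ps i)"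
  shows "mlop_solution E \<sigma>"
proof -
  let ?m = "length ps" and ?e = "edge_at vs ps"
  have e_map: "map (decode_edge vs) ps = map ?e [0..<?m]"
    by (rule nth_equalityI) (auto simp: edge_at_def)
  have "distinct (map ?e [0..<?m])" "set (map ?e [0..<?m]) = E"
    using pres unfolding presents_def e_map by auto
  then have inj: "inj_on ?e {..<?m}" and img: "?e ` {..<?m} = E"
    by (auto simp: distinct_map lessThan_atLeast0)
  have bij: "bij_betw ?e {..<?m} E" using inj img by (simp add: bij_betw_def)
  have m: "card E = ?m" using bij_betw_same_card[OF bij] by simp
  have fin: "finite E" using finite_edges[OF G(1)] .
  have dis: "pairwise disjnt (cycles E)"
    by (auto simp: pairwise_def disjnt_def dest: cactus_cycles_disjoint[OF G])
  have bij\<sigma>: "bij_betw \<sigma> E {1..card E}"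
  proof -
    have "bij_betw (\<sigma> \<circ> ?e) {..<?m} {1..?m}"
      using bij_betw_position[of ?m key] \<sigma> by (subst bij_betw_cong[of _ _ "position ?m key"]) auto
    then show ?thesis using bij m by (metis bij_betw_comp_iff)
  qed
  define idx where "idx F = {j. j < ?m \<and> ?e j \<in> F}" for F
  define pr where "pr F = code ?m (idx F)" for F
  have idx_sub: "idx F \<subseteq> {..<?m}" for F by (auto simp: idx_def)
  have e_idx: "?e ` idx F = F" if "F \<in> cycles E" for F
    using that img by (auto simp: idx_def cycles_def)
  have idx_ne: "idx F \<noteq> {}" if "F \<in> cycles E" for F
    using e_idx[OF that] cycles_nonempty[OF that] by auto
  have card_idx: "card (idx F) = card F" if "F \<in> cycles E" for F
    using card_image[OF inj_on_subset[OF inj idx_sub[of F]]] e_idx[OF that] by simp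
  have edge: "?e i = {vs ! fst (ps ! i), vs ! snd (ps ! i)}" for i
    by (simp add: edge_at_def decode_edge_def)
  have neq: "vs ! fst (ps ! i) \<noteq> vs ! snd (ps ! i)" if "i < ?m" for i
  proof -
    have "?e i \<in> E" using that img by blast
    then have "card (?e i) = 2" using G(1) by (simp add: simple_graph_def)
    then show ?thesis by (auto simp: edge)
  qed
  have minus: "?e ` ({..<?m} - {i, j}) = E - {?e i, ?e j}" if "i < ?m" "j < ?m" for i j
    using inj_on_image_set_diff[OF inj, of "{..<?m}" "{i, j}"] that img by auto
  have comp_cycle: "companions vs ps i = idx F" if "i < ?m" "F \<in> cycles E" "?e i \<in> F" for i F
  proof -
    have "i = j \<or> \<not> linked (E - {?e i, ?e j}) (vs ! fst (ps ! i)) (vs ! snd (ps ! i)) \<longleftrightarrow> ?e j \<in> F"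
      if j: "j < ?m" for j
    proof (cases "i = j")
      case False
      then have "?e j \<noteq> ?e i" using inj j \<open>i < ?m\<close> by (auto simp: inj_on_def)
      then show ?thesis
        using linked_minus_edges_iff[OF cactus_cycles_disjoint[OF G], where F = F
            and u = "vs ! fst (ps ! i)" and v = "vs ! snd (ps ! i)" and e = "?e j"] neq[OF \<open>i < ?m\<close>] that False \<open>F \<in> cycles E\<close> \<open>?e i \<in> F\<close>
        by (simp add: edge)
    qed (use \<open>?e i \<in> F\<close> in simp)
    then have "j \<in> companions vs ps i \<longleftrightarrow> j \<in> idx F" for j
      using minus[OF \<open>i < ?m\<close>, of j] unfolding companions_def idx_def mem_Collect_eq by metis
    then show ?thesis by auto
  qed
  have comp_bridge: "companions vs ps i = {..<?m}" if "i < ?m" "\<And>F. F \<in> cycles E \<Longrightarrow> ?e i \<notin> F" for i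
  proof -
    have "?e i \<in> E" using img \<open>i < ?m\<close> by blast
    then have "\<not> linked (E - {?e i, e}) (vs ! fst (ps ! i)) (vs ! snd (ps ! i))" for e
      using not_linked_minus_bridge[OF _ neq[OF \<open>i < ?m\<close>], where E = E and e = e] that(2)
      unfolding edge[of i] by blast
    then have "j \<in> companions vs ps i \<longleftrightarrow> j < ?m" for j
      using minus[OF \<open>i < ?m\<close>, of j] unfolding companions_def mem_Collect_eq by metis
    then show ?thesis by auto
  qed
  show ?thesis
  proof (rule mlop_solution_shortest_cycle_first[OF fin dis bij\<sigma>, of pr])
    show "inj_on pr (cycles E)"
    proof (rule inj_onI)
      fix F G' assume FG: "F \<in> cycles E" "G' \<in> cycles E" "pr F = pr G'"
      then have "Max (idx F) = Max (idx G')"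
        unfolding pr_def by (intro code_eq_imp_Max_eq[OF _ idx_sub idx_ne idx_sub idx_ne])
      moreover have "Max (idx X) \<in> idx X" if "X \<in> cycles E" for X
        using idx_ne[OF that] finite_subset[OF idx_sub] by (intro Max_in) auto
      ultimately have "?e (Max (idx F)) \<in> F \<inter> G'" using FG by (metis IntI e_idx imageI)
      then show "F = G'" using cactus_cycles_disjoint[OF G FG(1,2)] by auto
    qed
  next
    fix F G' assume FG: "F \<in> cycles E" "G' \<in> cycles E" "pr F < pr G'"
    then show "card F \<le> card G'"
      using code_less_imp_card_le[OF _ idx_sub idx_ne[OF FG(2)], where X = "idx F"] card_idx
      by (simp add: pr_def)
  next
    fix F e assume F: "F \<in> cycles E" and e: "e \<in> F"
    then obtain i where i: "i < ?m" "e = ?e i" using img by (auto simp: cycles_def)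
    have keyi: "key i = pr F" using key[OF i(1)] comp_cycle[OF i(1) F] e i by (simp add: pr_def)
    show "{f \<in> E. \<sigma> f \<le> \<sigma> e} \<subseteq> \<Union>{G \<in> cycles E. pr G \<le> pr F}"
    proof clarify
      fix f assume f: "f \<in> E" "\<sigma> f \<le> \<sigma> e"
      then obtain j where j: "j < ?m" "f = ?e j" using img by auto
      have le: "key j \<le> pr F"
        using position_le_imp_key_le[of ?m key j i] f(2) i j \<sigma> keyi by simp
      show "f \<in> \<Union>{G \<in> cycles E. pr G \<le> pr F}"
      proof (cases "\<exists>G'\<in>cycles E. f \<in> G'")
        case True
        then obtain G' where G': "G' \<in> cycles E" "f \<in> G'" by auto
        then have "key j = pr G'" using key[OF j(1)] comp_cycle[OF j(1)] j by (simp add: pr_def)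
        with le G' show ?thesis by auto
      next
        case False
        then have "companions vs ps j = {..<?m}" using comp_bridge[OF j(1)] j by auto
        then have keyj: "key j = code ?m {..<?m}" using key[OF j(1)] by simp
        have "j \<notin> idx F" using False F j by (auto simp: idx_def)
        then have "idx F \<subset> {..<?m}" using j idx_sub by auto
        \<comment> \<open>The bridge \<open>j\<close> is off the cycle, so \<open>F\<close> has at
          most \<open>?m - 1\<close> edges. Its largest index being below \<open>?m\<close>, its
          priority stays below \<open>?m * ?m\<close>, which the first summand of the key of a
          bridge already reaches.\<close>
        then have card: "Suc (card (idx F)) \<le> ?m"
          using psubset_card_mono[of "{..<?m}" "idx F"] by simp
        have "Suc (card (idx F)) * ?m \<le> ?m * ?m" using card by (rule mult_right_mono) simp
        then have "pr F < key j"
          using Max_lt_bound[OF idx_sub idx_ne[OF F]] unfolding pr_def keyj by (simp add: code_def)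
        with le show ?thesis by simp
      qed
    qed
  qed
qed

section \<open>The complete program and its running time\<close>

definition mlop_program :: com where
  "mlop_program = Seq compute_keys order_by_keys"

text \<open>Degree 4 comes from \<open>m ^ 3 * n\<close>: for each of \<open>m ^ 2\<close> pairs of
  edges, up to \<open>m\<close> merges that scan \<open>n\<close> cells. With
  \<open>S = 1 + (n + m)\<close> every monomial is at most \<open>S ^ 4\<close>; the coefficients
  add up to 302, rounded up to 400.\<close>

lemma mlop_program_time_le:
  fixes n m :: nat
  shows "1 + (m * ((m * (18 * n + 73 + m * (26 * n + 52)) + 14) + 13) + 10) + (m * (m * 55 + 30) + 10)
    \<le> 400 * (1 + (n + m)) ^ 4"
proof -
  define S where "S = 1 + (n + m)"
  have S: "n \<le> S" "m \<le> S" "1 \<le> S" by (auto simp: S_def)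
  have p: "S ^ a \<le> S ^ 4" if "a \<le> 4" for a using S(3) that by (rule power_increasing[rotated])
  have mon: "m ^ a * n ^ b \<le> S ^ 4" if "a + b \<le> 4" for a b
  proof -
    have "m ^ a * n ^ b \<le> S ^ a * S ^ b" using S by (intro mult_mono power_mono) auto
    also have "\<dots> \<le> S ^ 4" using p[OF that] by (simp add: power_add)
    finally show ?thesis .
  qed
  have "1 + (m * ((m * (18 * n + 73 + m * (26 * n + 52)) + 14) + 13) + 10) + (m * (m * 55 + 30) + 10)
      = 26 * (m ^ 3 * n ^ 1) + 52 * (m ^ 3 * n ^ 0) + 18 * (m ^ 2 * n ^ 1) + 128 * (m ^ 2 * n ^ 0)
        + 57 * (m ^ 1 * n ^ 0) + 21 * (m ^ 0 * n ^ 0)"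
    by (simp add: algebra_simps power2_eq_square power3_eq_cube)
  also have "\<dots> \<le> 26 * S ^ 4 + 52 * S ^ 4 + 18 * S ^ 4 + 128 * S ^ 4 + 57 * S ^ 4 + 21 * S ^ 4"
    by (intro add_mono mult_left_mono mon) auto
  also have "\<dots> \<le> 400 * S ^ 4" by simp
  finally show ?thesis by (simp add: S_def)
qed

theorem theorem4:
  "\<exists>(c :: com) (p :: nat poly). \<forall>(V :: 'a set) (E :: 'a set set) vs ps.
     simple_graph V E \<and> cactus V E \<and> presents vs ps V E \<longrightarrow>
       (\<exists>t s \<sigma>. exec c (input_state (card V) ps) t s \<and>
          t \<le> poly p (card V + card E) \<and>
          outputs_ordering s vs ps \<sigma> \<and> mlop_solution E \<sigma>)"
proof (intro exI[of _ mlop_program] exI[of _ "[:400:] * [:1, 1:] ^ 4"] allI impI, elim conjE)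
  fix V :: "'a set" and E vs ps
  assume G: "simple_graph V E" "cactus V E" and pres: "presents vs ps V E"
  let ?s = "input_state (card V) ps" and ?m = "length ps"
  have vs: "distinct vs" and n: "length vs = card V"
    and ps: "\<forall>p\<in>set ps. fst p < length vs \<and> snd p < length vs"
    and d: "distinct (map (decode_edge vs) ps)" and E: "set (map (decode_edge vs) ps) = E"
    using pres by (auto simp: presents_def distinct_card)
  have m: "card E = ?m" using distinct_card[OF d] E by simp
  have loaded: "loaded vs ps ?s" by (auto simp: loaded_def input_state_def n)
  define T where "T = 1 + (?m * ((?m * (18 * length vs + 73 + ?m * (26 * length vs + 52)) + 14) + 13) + 10)
     + (?m * (?m * 55 + 30) + 10)"
  \<comment> \<open>The keys are those of the intermediate state, so the postcondition on the final
    state quantifies over them.\<close>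
  have "runs mlop_program ?s T (\<lambda>s'. \<exists>key. (\<forall>i<?m. key i = code ?m (companions vs ps i)) \<and>
      (\<forall>i<?m. s' ''sigma'' i = position ?m key i))"
    unfolding mlop_program_def T_def
  proof (rule runs_Seq[OF runs_compute_keys[OF loaded vs ps]])
    fix s1 assume s1: "(\<forall>i<?m. s1 ''key'' i = code ?m (companions vs ps i)) \<and> s1 ''m'' = ?s ''m''"
    then have "s1 ''m'' 0 = ?m" using loaded by (simp add: loaded_def)
    from runs_order_by_keys[where s = s1, OF this]
    show "runs order_by_keys s1 (?m * (?m * 55 + 30) + 10)
      (\<lambda>s'. \<exists>key. (\<forall>i<?m. key i = code ?m (companions vs ps i)) \<and>
      (\<forall>i<?m. s' ''sigma'' i = position ?m key i))"
      by (rule runs_mono) (use s1 in auto)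
  qed
  then obtain t s key where exec: "exec mlop_program ?s t s" "t \<le> T"
    and key: "\<And>i. i < ?m \<Longrightarrow> key i = code ?m (companions vs ps i)"
    and sigma: "\<And>i. i < ?m \<Longrightarrow> s ''sigma'' i = position ?m key i"
    by (auto simp: runs_def)
  \<comment> \<open>The machine indexes positions by edge number, \<open>mlop_solution\<close> by
    the edge itself. A presentation lists each edge once, so the number can be recovered from the
    edge.\<close>
  define \<sigma> where "\<sigma> e = s ''sigma'' (THE k. k < ?m \<and> edge_at vs ps k = e)" for e
  have \<sigma>: "\<sigma> (edge_at vs ps k) = s ''sigma'' k" if "k < ?m" for k
  proof -
    have "(THE k'. k' < ?m \<and> edge_at vs ps k' = edge_at vs ps k) = k"
      using that d by (intro the_equality) (auto simp: edge_at_def distinct_conv_nth)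
    then show ?thesis by (simp add: \<sigma>_def)
  qed
  have "outputs_ordering s vs ps \<sigma>"
    using \<sigma> by (auto simp: outputs_ordering_def edge_at_def)
  moreover have "mlop_solution E \<sigma>"
    by (rule cactus_keys_give_solution[OF G pres, of \<sigma> key]) (use \<sigma> sigma key in auto)
  moreover have "T \<le> poly ([:400:] * [:1, 1:] ^ 4) (card V + card E)"
    using mlop_program_time_le[of ?m "length vs"] by (simp add: T_def n m)
  then have "t \<le> poly ([:400:] * [:1, 1:] ^ 4) (card V + card E)" using exec(2) by (rule order_trans[rotated])
  ultimately show "\<exists>t s \<sigma>. exec mlop_program ?s t s \<and>
      t \<le> poly ([:400:] * [:1, 1:] ^ 4) (card V + card E) \<and> outputs_ordering s vs ps \<sigma> \<and> mlop_solution E \<sigma>"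
    using exec(1) by blast
qed

end
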